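(* **Part A (non-compact phase space, strictly isotropic tori).** Let $N,n,d$ be integers with $N\ge 2$, $1\le n\le N-1$, $0\le d\le 2N-n$, and let $\omega\in\mathbb R^n$ be any vector. Then there exist an exact symplectic form $\Omega$ with constant coefficients on the manifold $\mathcal M=\mathbb R^{2N-n}_w\times\mathbb T^n_\varphi$ and a Hamilton function $H:\mathcal M\to\mathbb R$, independent of $\varphi$ and polynomial in $w$, such that the corresponding Hamiltonian system on $\mathcal M$ has the following properties. (i) It admits a $d$-parameter analytic family of strictly isotropic Kronecker $n$-tori of the form $\{w=\mathrm{const}\}$. (ii) There are no Kronecker tori (of any dimension) outside this family, i.e., no point of $\mathcal M$ outside the union of the tori of the family belongs to a Kronecker torus of any dimension. (iii) The $n$-torus $\{w=0\}$ belongs to this family and its frequency vector is equal to $\omega$. (iv) If $d=0$ then the torus $\{w=0\}$ is unique. (v) If $d=2N-n$ then the family makes up the whole phase space $\mathcal M$. **Part B (non-compact phase space, atropic tori).** Let $N,n,d$ be integers with $N\ge 3$, $3\le n\le 2N-3$, $0\le d\le 2N-n$, and let $\omega\in\mathbb R^n$ be any vector. Then there exist a non-exact symplectic form $\Omega$ with constant coefficients on the manifold $\mathcal M=\mathbb R^{2N-n}_w\times\mathbb T^n_\varphi$ and a Hamilton function $H:\mathcal M\to\mathbb R$, independent of $\varphi$ and polynomial in $w$, such that the corresponding Hamiltonian system on $\mathcal M$ has the following properties. (i) It admits a $d$-parameter analytic family of atropic Kronecker $n$-tori of the form $\{w=\mathrm{const}\}$. (ii) There are no Kronecker tori (of any dimension)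 outside this family, i.e., no point of $\mathcal M$ outside the union of the tori of the family belongs to a Kronecker torus of any dimension. (iii) The $n$-torus $\{w=0\}$ belongs to this family and its frequency vector is equal to $\omega$. (iv) If $d=0$ then the torus $\{w=0\}$ is unique. (v) If $d=2N-n$ then the family makes up the whole phase space $\mathcal M$. **Part C (compact phase space).** Let $N,n,d$ be integers and $\omega\in\mathbb R^n$ any vector, where either (C1) $N\ge 2$, $1\le n\le N-1$, $0\le d\le 2N-n$, or (C2) $N\ge 3$, $3\le n\le 2N-3$, $0\le d\le 2N-n$. Then, in each of these two cases, there exist a (non-exact) symplectic form $\Omega$ with constant coefficients on the compact manifold $\widehat{\mathcal M}=\mathbb T^{2N-n}_w\times\mathbb T^n_\varphi$ and a Hamilton function $H:\widehat{\mathcal M}\to\mathbb R$, independent of $\varphi$ and trigonometric polynomial in $w$, such that the corresponding Hamiltonian system on $\widehat{\mathcal M}$ has the following properties. (i) It admits a $d$-parameter analytic family of Kronecker $n$-tori of the form $\{w=\mathrm{const}\}$, all of which are strictly isotropic in case (C1) and atropic in case (C2). (ii) The $n$-torus $\{w=0\}$ belongs to this family and its frequency vector is equal to $\omega$. (iii) If $d=0$ then the torus $\{w=0\}$ is strongly isolated. (iv) If $d=2N-n$ then the family makes up the whole phase space $\widehat{\mathcal M}$. (In Part C it is not asserted that there are no Kronecker tori outside the family.)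
   Context: **Notation.** $\mathbb T^a=(\mathbb R/2\pi\mathbb Z)^a$. $\mathbb R^a_w$ denotes $\mathbb R^a$ with coordinates $w=(w_1,\dots,w_a)$, and $\mathbb T^a_\varphi$ (or $\mathbb T^a_w$) denotes $\mathbb T^a$ with angular coordinates $\varphi=(\varphi_1,\dots,\varphi_a)$ (or $w$). **Kronecker tori.** Given a flow on a manifold, a Kronecker $n$-torus ($n\ge 0$ an integer), i.e., an invariant $n$-torus carrying conditionally periodic motions, is an invariant submanifold $\mathcal T$ diffeomorphic to $\mathbb T^n$ such that in a suitable angular coordinate $\varphi\in\mathbb T^n$ on $\mathcal T$ the induced dynamics is $\dot\varphi=\omega$ with a constant vector $\omega\in\mathbb R^n$, called the frequency vector. No non-resonance condition is imposed on $\omega$; a Kronecker $0$-torus is an equilibrium. For tori of the form $\{w=\mathrm{const}\}$ in $\mathbb R^{2N-n}_w\times\mathbb T^n_\varphi$ or $\mathbb T^{2N-n}_w\times\mathbb T^n_\varphi$, the frequency vector is taken with respect to the coordinate $\varphi$. **Families.** A $d$-parameter analytic family of tori of the form $\{w=\mathrm{const}\}$ is a collection $\{w=w^0\}$, $w^0\in S$, where $S$ is a (not necessarily connected) $d$-dimensional real-analytic submanifold of the $w$-space. The family makes up the whole phase space if $S$ is the whole $w$-space. **Symplectic notions.** A differential form on the manifolds above has constant coefficients if its coefficients in the coordinates $(w,\varphi)$ are constant. The Hamiltonian vector field $X$ of $H$ is defined by $\Omega(Y,X)=dH(Y)$ for all tangent vectors $Y$. For a submanifold $\mathcal L$ of a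 $2N$-dimensional symplectic manifold, let $(T_\Lambda\mathcal L)^\bot$ be the skew-orthogonal complement (with respect to $\Omega$) of the tangent space $T_\Lambda\mathcal L$. $\mathcal L$ is isotropic if $T_\Lambda\mathcal L\subset(T_\Lambda\mathcal L)^\bot$ for every $\Lambda\in\mathcal L$; coisotropic if $(T_\Lambda\mathcal L)^\bot\subset T_\Lambda\mathcal L$ for every $\Lambda\in\mathcal L$; strictly isotropic if it is isotropic and $\dim\mathcal L<N$; atropic if it is neither isotropic nor coisotropic. **Isolatedness.** A Kronecker torus $\mathcal T$ of a dynamical system is strongly isolated if there is a neighborhood $\mathcal O$ of $\mathcal T$ in the phase space such that there are no Kronecker tori (of any dimension) entirely contained in $\mathcal O\setminus\mathcal T$. It is unique if there are no Kronecker tori (of any dimension) outside $\mathcal T$ in the whole phase space (i.e., one can take $\mathcal O$ to be the whole phase space). *)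

theory Defs
  imports "HOL-Analysis.Analysis"
begin

section \<open>Smooth and real-analytic maps\<close>

text \<open>
  \<open>C_diff k f\<close>: the map \<open>f\<close>, defined on a whole Euclidean space, is of class \<open>C\<close> to the \<open>k\<close>.
\<close>

primrec C_diff :: "nat \<Rightarrow> ('a::euclidean_space \<Rightarrow> 'b::real_normed_vector) \<Rightarrow> bool" where
  "C_diff 0 f \<longleftrightarrow> continuous_on UNIV f"
| "C_diff (Suc k) f \<longleftrightarrow>
     (\<forall>x. f differentiable (at x)) \<and> (\<forall>v. C_diff k (\<lambda>x. frechet_derivative f (at x) v))"

definition smooth :: "('a::euclidean_space \<Rightarrow> 'b::real_normed_vector) \<Rightarrow> bool" where
  "smooth f \<longleftrightarrow> (\<forall>k. C_diff k f)"

text \<open>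
  Local expansion into a power series in several variables; \<open>\<alpha>\<close> ranges over all multi-indices.
\<close>

definition real_analytic_on ::
    "(real ^ 'a \<Rightarrow> 'b::real_normed_vector) \<Rightarrow> (real ^ 'a) set \<Rightarrow> bool"  (infix "real'_analytic'_on" 50)
  where
  "f real_analytic_on U \<longleftrightarrow>
     (\<forall>x\<in>U. \<exists>r>0. \<exists>c :: ('a \<Rightarrow> nat) \<Rightarrow> 'b. \<forall>y\<in>ball x r.
        ((\<lambda>\<alpha>. (\<Prod>i\<in>UNIV. (y $ i - x $ i) ^ \<alpha> i) *\<^sub>R c \<alpha>) has_sum f y) UNIV)"

text \<open>
  A \<open>d\<close>-dimensional real-analytic submanifold (not necessarily connected or closed): near each
  of its points it is a \<open>d\<close>-dimensional coordinate plane in a suitable analytic chart \<open>\<Phi>\<close> with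
  analytic inverse \<open>\<Psi>\<close>.
\<close>

definition analytic_submanifold :: "nat \<Rightarrow> (real ^ 'a) set \<Rightarrow> bool" where
  "analytic_submanifold d S \<longleftrightarrow>
     (\<forall>p\<in>S. \<exists>U \<Phi> \<Psi>. \<exists>I :: 'a set.
        open U \<and> p \<in> U \<and> open (\<Phi> ` U) \<and>
        \<Phi> real_analytic_on U \<and> \<Psi> real_analytic_on (\<Phi> ` U) \<and> (\<forall>x\<in>U. \<Psi> (\<Phi> x) = x) \<and>
        card I = d \<and>
        (\<forall>x\<in>U. x \<in> S \<longleftrightarrow> (\<forall>i. i \<notin> I \<longrightarrow> \<Phi> x $ i = 0)))"

definition trigonometric_polynomial :: "(real ^ 'a \<Rightarrow> real) \<Rightarrow> bool" where
  "trigonometric_polynomial h \<longleftrightarrow>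
     (\<exists>(K :: (int ^ 'a) set) a b. finite K \<and>
        (\<forall>w. h w = (\<Sum>k\<in>K. a k * cos (\<Sum>i\<in>UNIV. of_int (k $ i) * w $ i)
                         + b k * sin (\<Sum>i\<in>UNIV. of_int (k $ i) * w $ i))))"


section \<open>The phase spaces\<close>

text \<open>
  The torus \<open>(\<real>/2\<pi>\<int>)\<^sup>a\<close> is realised as the product of \<open>a\<close> unit circles in the complex plane;
  \<open>angles\<close> sends angular coordinates to the corresponding point.
\<close>

definition angles :: "real ^ 'a \<Rightarrow> complex ^ 'a" where
  "angles x = (\<chi> i. cis (x $ i))"

abbreviation torus :: "(complex ^ 'a) set" where
  "torus \<equiv> range angles"

text \<open>
  \<open>coords \<kappa>\<close> sends the coordinates \<open>(w, \<phi>)\<close> to a point of the phase space. Here \<open>\<kappa>\<close> does the same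
  for the \<open>w\<close>-space \<open>range \<kappa>\<close>: \<open>\<kappa> = id\<close> if this is a Euclidean space, and \<open>\<kappa> = angles\<close> if it is a
  torus.

  Below, \<open>\<pi> :: 'v \<Rightarrow> 'p\<close> is always such a coordinate map. It is the universal covering of the phase
  space \<open>range \<pi>\<close>, so all tangent spaces of the phase space are identified with \<open>'v\<close>, and a map from
  a Euclidean space to the phase space is smooth iff it is \<open>\<pi> \<circ> F\<close> for a smooth \<open>F\<close>.
  A vector field is a function \<open>X :: 'p \<Rightarrow> 'v\<close>.
\<close>

definition coords ::
    "(real ^ 'w \<Rightarrow> 'b) \<Rightarrow> (real ^ 'w) \<times> (real ^ 'n) \<Rightarrow> 'b \<times> (complex ^ 'n)" where
  "coords \<kappa> = (\<lambda>(w, \<phi>). (\<kappa> w, angles \<phi>))"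


section \<open>Symplectic notions\<close>

text \<open>
  A 2-form with constant coefficients is an alternating bilinear form on \<open>'v\<close>; it is automatically
  closed.
\<close>

definition symplectic_form :: "('v::euclidean_space \<Rightarrow> 'v \<Rightarrow> real) \<Rightarrow> bool" where
  "symplectic_form \<Omega> \<longleftrightarrow>
     bilinear \<Omega> \<and> (\<forall>u. \<Omega> u u = 0) \<and> (\<forall>u. u \<noteq> 0 \<longrightarrow> (\<exists>v. \<Omega> u v \<noteq> 0))"

text \<open>
  \<open>\<Omega> = d\<alpha>\<close> for a smooth 1-form \<open>\<alpha>\<close> on the phase space (whose coefficients need not be constant).
  For constant vector fields \<open>u\<close>, \<open>v\<close> one has \<open>d\<alpha>(u,v) = u(\<alpha>(v)) - v(\<alpha>(u))\<close>.
\<close>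

definition exact_form ::
    "('v::euclidean_space \<Rightarrow> 'p) \<Rightarrow> ('v \<Rightarrow> 'v \<Rightarrow> real) \<Rightarrow> bool" where
  "exact_form \<pi> \<Omega> \<longleftrightarrow>
     (\<exists>\<alpha> :: 'p \<Rightarrow> 'v \<Rightarrow> real.
        (\<forall>x. linear (\<alpha> (\<pi> x))) \<and>
        (\<forall>v. smooth (\<lambda>x. \<alpha> (\<pi> x) v)) \<and>
        (\<forall>x u v. \<Omega> u v = frechet_derivative (\<lambda>y. \<alpha> (\<pi> y) v) (at x) u
                       - frechet_derivative (\<lambda>y. \<alpha> (\<pi> y) u) (at x) v))"

text \<open>
  The equation \<open>\<Omega>(Y,X) = dH(Y)\<close>. If \<open>\<Omega>\<close> is symplectic, it determines \<open>X\<close> on \<open>range \<pi>\<close> uniquely.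
\<close>

definition hamiltonian_vector_field ::
    "('v::euclidean_space \<Rightarrow> 'p) \<Rightarrow> ('v \<Rightarrow> 'v \<Rightarrow> real) \<Rightarrow> ('p \<Rightarrow> real) \<Rightarrow> ('p \<Rightarrow> 'v) \<Rightarrow> bool" where
  "hamiltonian_vector_field \<pi> \<Omega> H X \<longleftrightarrow>
     (\<forall>x. ((H \<circ> \<pi>) has_derivative (\<lambda>Y. \<Omega> Y (X (\<pi> x)))) (at x))"

text \<open>
  The tangent space at \<open>p\<close> of a submanifold \<open>L\<close> of the phase space consists of the velocities of
  the smooth curves in \<open>L\<close> passing through \<open>p\<close>.
\<close>

definition tangent_space ::
    "('v::euclidean_space \<Rightarrow> 'p) \<Rightarrow> 'p set \<Rightarrow> 'p \<Rightarrow> 'v set" where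
  "tangent_space \<pi> L p =
     {v. \<exists>\<gamma> :: real \<Rightarrow> 'v. smooth \<gamma> \<and> (\<forall>t. \<pi> (\<gamma> t) \<in> L) \<and> \<pi> (\<gamma> 0) = p \<and>
           (\<gamma> has_vector_derivative v) (at 0)}"

definition skew_complement :: "('v \<Rightarrow> 'v \<Rightarrow> real) \<Rightarrow> 'v set \<Rightarrow> 'v set" where
  "skew_complement \<Omega> W = {v. \<forall>u\<in>W. \<Omega> v u = 0}"

definition isotropic ::
    "('v::euclidean_space \<Rightarrow> 'p) \<Rightarrow> ('v \<Rightarrow> 'v \<Rightarrow> real) \<Rightarrow> 'p set \<Rightarrow> bool" where
  "isotropic \<pi> \<Omega> L \<longleftrightarrow>
     (\<forall>p\<in>L. tangent_space \<pi> L p \<subseteq> skew_complement \<Omega> (tangent_space \<pi> L p))"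

definition coisotropic ::
    "('v::euclidean_space \<Rightarrow> 'p) \<Rightarrow> ('v \<Rightarrow> 'v \<Rightarrow> real) \<Rightarrow> 'p set \<Rightarrow> bool" where
  "coisotropic \<pi> \<Omega> L \<longleftrightarrow>
     (\<forall>p\<in>L. skew_complement \<Omega> (tangent_space \<pi> L p) \<subseteq> tangent_space \<pi> L p)"

text \<open>The phase space has dimension \<open>DIM('v) = 2 N\<close>, so \<open>dim L < N\<close> reads as follows.\<close>

definition strictly_isotropic ::
    "('v::euclidean_space \<Rightarrow> 'p) \<Rightarrow> ('v \<Rightarrow> 'v \<Rightarrow> real) \<Rightarrow> 'p set \<Rightarrow> bool" where
  "strictly_isotropic \<pi> \<Omega> L \<longleftrightarrow>
     isotropic \<pi> \<Omega> L \<and> (\<forall>p\<in>L. 2 * dim (tangent_space \<pi> L p) < DIM('v))"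

definition atropic ::
    "('v::euclidean_space \<Rightarrow> 'p) \<Rightarrow> ('v \<Rightarrow> 'v \<Rightarrow> real) \<Rightarrow> 'p set \<Rightarrow> bool" where
  "atropic \<pi> \<Omega> L \<longleftrightarrow> \<not> isotropic \<pi> \<Omega> L \<and> \<not> coisotropic \<pi> \<Omega> L"


section \<open>Kronecker tori\<close>

text \<open>
  A smooth embedding of the torus with angular coordinates \<open>(\<theta> \<bullet> b)\<close>, \<open>b \<in> J\<close>, into the phase space,
  lifted to a map \<open>F\<close> between coordinate spaces, that carries the constant vector field \<open>\<omega>\<close> on the
  torus to \<open>X\<close>. The torus has dimension \<open>card J\<close>. Coordinates \<open>\<theta> \<bullet> b\<close> with \<open>b \<notin> J\<close> are dummies: the
  second condition (the map is well defined and injective on the torus) and the continuity of \<open>F\<close>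
  imply that \<open>F\<close> does not depend on them. The third condition says that the map is an immersion.
\<close>

definition kronecker_parametrization ::
    "('v::euclidean_space \<Rightarrow> 'p) \<Rightarrow> ('p \<Rightarrow> 'v) \<Rightarrow> 'j::euclidean_space set \<Rightarrow> 'j \<Rightarrow> ('j \<Rightarrow> 'v) \<Rightarrow> bool" where
  "kronecker_parametrization \<pi> X J \<omega> F \<longleftrightarrow>
     smooth F \<and>
     (\<forall>\<theta> \<theta>'. \<pi> (F \<theta>) = \<pi> (F \<theta>') \<longleftrightarrow> (\<forall>b\<in>J. cis (\<theta> \<bullet> b) = cis (\<theta>' \<bullet> b))) \<and>
     (\<forall>\<theta> v. frechet_derivative F (at \<theta>) v = 0 \<longleftrightarrow> (\<forall>b\<in>J. v \<bullet> b = 0)) \<and>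
     (\<forall>\<theta>. frechet_derivative F (at \<theta>) \<omega> = X (\<pi> (F \<theta>)))"

text \<open>
  The dimension \<open>m\<close> of an embedded torus is at most \<open>DIM('v)\<close>; hence every embedded torus
  admits angular coordinates indexed by a set of basis vectors of \<open>'v\<close>.
\<close>

definition kronecker_torus ::
    "('v::euclidean_space \<Rightarrow> 'p) \<Rightarrow> ('p \<Rightarrow> 'v) \<Rightarrow> nat \<Rightarrow> 'p set \<Rightarrow> bool" where
  "kronecker_torus \<pi> X m T \<longleftrightarrow>
     (\<exists>J \<omega>. \<exists>F :: 'v \<Rightarrow> 'v. J \<subseteq> Basis \<and> card J = m \<and> kronecker_parametrization \<pi> X J \<omega> F \<and>
        T = range (\<pi> \<circ> F))"

text \<open>The torus with fixed \<open>w\<close> is a Kronecker torus with frequency vector \<open>\<omega>\<close> in the coordinate \<open>\<phi>\<close>.\<close>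

definition has_frequency_vector ::
    "(real ^ 'w \<Rightarrow> 'b) \<Rightarrow> ('b \<times> (complex ^ 'n) \<Rightarrow> (real ^ 'w) \<times> (real ^ 'n)) \<Rightarrow>
     real ^ 'w \<Rightarrow> real ^ 'n \<Rightarrow> bool" where
  "has_frequency_vector \<kappa> X w \<omega> \<longleftrightarrow>
     kronecker_parametrization (coords \<kappa>) X Basis \<omega> (\<lambda>\<phi>. (w, \<phi>))"

text \<open>
  The tori \<open>{s} \<times> torus\<close>, \<open>s \<in> S\<close>, form a \<open>d\<close>-parameter analytic family of Kronecker tori.
  Since \<open>\<kappa>\<close> is a local analytic diffeomorphism onto the \<open>w\<close>-space, \<open>S\<close> is an analytic
  submanifold of the latter iff \<open>\<kappa> -` S\<close> is one.
\<close>

definition kronecker_family ::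
    "(real ^ 'w \<Rightarrow> 'b) \<Rightarrow> ('b \<times> (complex ^ 'n) \<Rightarrow> (real ^ 'w) \<times> (real ^ 'n)) \<Rightarrow> nat \<Rightarrow> 'b set \<Rightarrow> bool"
  where
  "kronecker_family \<kappa> X d S \<longleftrightarrow>
     S \<subseteq> range \<kappa> \<and> analytic_submanifold d (\<kappa> -` S) \<and>
     (\<forall>s\<in>S. kronecker_torus (coords \<kappa>) X CARD('n) ({s} \<times> torus))"

definition isolating_neighbourhood ::
    "('v::euclidean_space \<Rightarrow> 'p::topological_space) \<Rightarrow> ('p \<Rightarrow> 'v) \<Rightarrow> 'p set \<Rightarrow> 'p set \<Rightarrow> bool" where
  "isolating_neighbourhood \<pi> X T U \<longleftrightarrow>
     openin (top_of_set (range \<pi>)) U \<and> T \<subseteq> U \<and>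
     (\<nexists>m T'. kronecker_torus \<pi> X m T' \<and> T' \<subseteq> U - T)"

definition strongly_isolated ::
    "('v::euclidean_space \<Rightarrow> 'p::topological_space) \<Rightarrow> ('p \<Rightarrow> 'v) \<Rightarrow> 'p set \<Rightarrow> bool" where
  "strongly_isolated \<pi> X T \<longleftrightarrow> (\<exists>U. isolating_neighbourhood \<pi> X T U)"

definition unique_torus ::
    "('v::euclidean_space \<Rightarrow> 'p::topological_space) \<Rightarrow> ('p \<Rightarrow> 'v) \<Rightarrow> 'p set \<Rightarrow> bool" where
  "unique_torus \<pi> X T \<longleftrightarrow> isolating_neighbourhood \<pi> X T (range \<pi>)"

end

theory Submission
  imports Defs
begin

text \<open>
  Write \<open>s\<close> for the identity (non-compact case) or the sine (compact case) and take
  \<open>\<Omega>(u, v) = J u \<bullet> v\<close> with an orthogonal complex structure \<open>J\<close>; the Hamiltonian vector field is then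
  \<open>J (grad, 0)\<close>. Choose \<open>J\<close> so that some coordinate direction \<open>p\<^sub>0\<close> of the \<open>w\<close>-space goes to a unit vector
  \<open>e\<close> of the \<open>\<phi>\<close>-space with \<open>\<omega> = r e\<close>, and another one, \<open>q\<close>, goes to a third one, \<open>p\<close>. For a set \<open>Z\<close> of
  \<open>2 N - n - d\<close> indices containing \<open>q\<close> (or empty), the Hamiltonian
  \<open>r s(w\<^sub>p\<^sub>0) + s(w\<^sub>q)\<^sup>3 / 3 + s(w\<^sub>q) \<Sum>\<^sub>i s(w\<^sub>i)\<^sup>2\<close>, the sum being over \<open>Z - {q}\<close> (only
  the first term if \<open>Z\<close> is empty), generates the motion \<open>\<phi>' = \<omega>\<close> on \<open>w = 0\<close>, makes every torus with \<open>w\<^sub>i = 0\<close> for all \<open>i \<in> Z\<close> invariant, and has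
  \<open>w\<^sub>p' = s'(w\<^sub>q) \<Sum>\<^sub>i s(w\<^sub>i)\<^sup>2\<close>, now summed over \<open>Z\<close>. Since conditionally periodic motions are
  recurrent, a Kronecker torus in the region where all \<open>s'(w\<^sub>i)\<close> are positive cannot support a strictly
  increasing \<open>s(w\<^sub>p)\<close>, so it lies where \<open>w\<^sub>i = 0\<close> for all \<open>i \<in> Z\<close>. The tori are isotropic if \<open>J\<close> maps
  the \<open>\<phi>\<close>-space into the \<open>w\<close>-space and atropic otherwise.
\<close>

section \<open>Smooth, analytic and trigonometric functions\<close>

lemma C_diff_const: "C_diff k (\<lambda>x. c)"
  by (induction k arbitrary: c) auto

lemma smooth_affine:
  fixes f :: "'a::euclidean_space \<Rightarrow> 'b::real_normed_vector"
  assumes "linear f"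
  shows "smooth (\<lambda>x. c + f x)"
  unfolding smooth_def
proof
  fix k
  have der: "((\<lambda>x. c + f x) has_derivative f) (at x)" for x
    using assms by (auto intro!: derivative_eq_intros linear_imp_has_derivative)
  show "C_diff k (\<lambda>x. c + f x)"
  proof (cases k)
    case 0
    then show ?thesis
      using der by (auto intro!: continuous_at_imp_continuous_on has_derivative_continuous)
  next
    case (Suc l)
    then show ?thesis
      using der by (auto simp: differentiable_def C_diff_const simp flip: frechet_derivative_at[OF der])
  qed
qed

lemma smooth_has_derivative:
  assumes "smooth f"
  shows "(f has_derivative frechet_derivative f (at x)) (at x)"
  using assms C_diff.simps(2)[of 0 f] unfolding smooth_def by (metis frechet_derivative_works)

lemma smooth_continuous_derivative:
  assumes "smooth f"
  shows "continuous_on UNIV (\<lambda>x. frechet_derivative f (at x) v)"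
  using assms C_diff.simps(2)[of 0 f] unfolding smooth_def by (metis C_diff.simps(1))

lemma real_analytic_on_translation:
  "(\<lambda>x. x + c) real_analytic_on (U :: (real ^ 'a) set)"
  unfolding real_analytic_on_def
proof (intro ballI exI[of _ "1::real"] conjI)
  fix x :: "real ^ 'a"
  \<comment> \<open>\<open>e j\<close> is the multi-index of the monomial
    \<open>y $ j - x $ j\<close>. A translation expands into the constant term \<open>x + c\<close>
    and these linear terms only, so the radius 1 is arbitrary.\<close>
  define e :: "'a \<Rightarrow> 'a \<Rightarrow> nat" where "e j = (\<lambda>i. if i = j then 1 else 0)" for j
  define b :: "('a \<Rightarrow> nat) \<Rightarrow> real ^ 'a"
    where "b \<alpha> = (if \<alpha> = (\<lambda>_. 0) then x + c else if \<alpha> \<in> range e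
       then axis (inv e \<alpha>) 1 else 0)" for \<alpha>
  have ne: "(\<lambda>_. 0) \<notin> range e"
  proof
    assume "(\<lambda>_. 0) \<in> range e"
    then obtain j where "e j = (\<lambda>_. 0)" by auto
    from fun_cong[OF this, of j] show False by (simp add: e_def)
  qed
  have inj: "inj e"
    by (rule injI) (auto simp: e_def fun_eq_iff split: if_splits)
  have prod_e: "(\<Prod>i\<in>UNIV. t i ^ e j i) = t j" for t :: "'a \<Rightarrow> real" and j
  proof -
    have "(\<Prod>i\<in>UNIV. t i ^ e j i) = (\<Prod>i\<in>UNIV. if i = j then t i else 1)"
      by (rule prod.cong) (auto simp: e_def)
    then show ?thesis by simp
  qed
  have "((\<lambda>\<alpha>. (\<Prod>i\<in>UNIV. (y $ i - x $ i) ^ \<alpha> i) *\<^sub>R b \<alpha>) has_sum y + c) UNIV" for y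
  proof (rule has_sum_finite_neutralI)
    show "finite (insert (\<lambda>_. 0) (range e))" by simp
    have "(\<Sum>\<alpha>\<in>range e. (\<Prod>i\<in>UNIV. (y $ i - x $ i) ^ \<alpha> i) *\<^sub>R b \<alpha>)
        = (\<Sum>j\<in>UNIV. (\<Prod>i\<in>UNIV. (y $ i - x $ i) ^ e j i) *\<^sub>R b (e j))"
      using inj by (simp add: sum.reindex)
    also have "\<dots> = (\<Sum>j\<in>UNIV. (y $ j - x $ j) *\<^sub>R axis j 1)"
    proof (rule sum.cong)
      fix j
      have "b (e j) = axis j 1"
        using ne inj by (simp add: b_def) (metis rangeI)
      then show "(\<Prod>i\<in>UNIV. (y $ i - x $ i) ^ e j i) *\<^sub>R b (e j) = (y $ j - x $ j) *\<^sub>R axis j 1"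
        by (simp add: prod_e)
    qed simp
    also have "\<dots> = y - x"
      by (simp add: vec_eq_iff axis_def if_distrib cong: if_cong)
    finally show "y + c = (\<Sum>\<alpha>\<in>insert (\<lambda>_. 0) (range e).
        (\<Prod>i\<in>UNIV. (y $ i - x $ i) ^ \<alpha> i) *\<^sub>R b \<alpha>)"
      using ne by (simp add: b_def)
  qed (auto simp: b_def)
  then show "\<exists>b. \<forall>y\<in>ball x 1.
      ((\<lambda>\<alpha>. (\<Prod>i\<in>UNIV. (y $ i - x $ i) ^ \<alpha> i) *\<^sub>R b \<alpha>) has_sum y + c) UNIV"
    by blast
qed simp

section \<open>Trigonometric polynomials form an algebra\<close>

lemma trigonometric_polynomial_add:
  assumes "trigonometric_polynomial f" "trigonometric_polynomial g"
  shows "trigonometric_polynomial (\<lambda>w. f w + g w)"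
proof -
  obtain K :: "(int ^ 'a) set" and a b where K: "finite K"
    "\<And>w. f w = (\<Sum>k\<in>K. a k * cos (\<Sum>i\<in>UNIV. of_int (k $ i) * w $ i)
                         + b k * sin (\<Sum>i\<in>UNIV. of_int (k $ i) * w $ i))"
    using assms(1) unfolding trigonometric_polynomial_def by blast
  obtain L :: "(int ^ 'a) set" and a' b' where L: "finite L"
    "\<And>w. g w = (\<Sum>k\<in>L. a' k * cos (\<Sum>i\<in>UNIV. of_int (k $ i) * w $ i)
                         + b' k * sin (\<Sum>i\<in>UNIV. of_int (k $ i) * w $ i))"
    using assms(2) unfolding trigonometric_polynomial_def by blast
  \<comment> \<open>Coefficients are extended by zero, so that both sums run over the same frequency
    set \<open>K \<union> L\<close>.\<close>
  define r where "r M x k = (if k \<in> M then x k else 0)" for M :: "(int ^ 'a) set" and x :: "int ^ 'a \<Rightarrow> real" and k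
  have ext: "(\<Sum>k\<in>M. x k * C k + y k * S k) = (\<Sum>k\<in>K \<union> L. r M x k * C k + r M y k * S k)"
    if "M \<subseteq> K \<union> L" for M x y and C S :: "int ^ 'a \<Rightarrow> real"
    using that K(1) L(1) by (intro sum.mono_neutral_cong_left) (auto simp: r_def)
  show ?thesis
    unfolding trigonometric_polynomial_def
  proof (intro exI conjI allI)
    show "finite (K \<union> L)" using K L by simp
    show "f w + g w = (\<Sum>k\<in>K \<union> L. (r K a k + r L a' k) * cos (\<Sum>i\<in>UNIV. of_int (k $ i) * w $ i)
                         + (r K b k + r L b' k) * sin (\<Sum>i\<in>UNIV. of_int (k $ i) * w $ i))" for w
      unfolding K(2) L(2) ext[of K, OF Un_upper1] ext[of L, OF Un_upper2] sum.distrib[symmetric]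
      by (simp add: algebra_simps)
  qed
qed

lemma trigonometric_polynomial_harmonic:
  fixes k :: "int ^ 'a"
  shows "trigonometric_polynomial (\<lambda>w. a * cos (\<Sum>i\<in>UNIV. of_int (k $ i) * w $ i)
            + b * sin (\<Sum>i\<in>UNIV. of_int (k $ i) * w $ i))"
  unfolding trigonometric_polynomial_def
  by (intro exI[of _ "{k}"] exI[of _ "\<lambda>_. a"] exI[of _ "\<lambda>_. b"]) simp

lemma trigonometric_polynomial_const: "trigonometric_polynomial (\<lambda>w. c)"
  using trigonometric_polynomial_harmonic[of c 0 0] by simp

lemma trigonometric_polynomial_sum:
  assumes "finite A" "\<And>x. x \<in> A \<Longrightarrow> trigonometric_polynomial (f x)"
  shows "trigonometric_polynomial (\<lambda>w. \<Sum>x\<in>A. f x w)"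
  using assms
  by (induction A rule: finite_induct)
    (auto intro: trigonometric_polynomial_add trigonometric_polynomial_const)

lemma trigonometric_polynomial_mult:
  assumes "trigonometric_polynomial f" "trigonometric_polynomial g"
  shows "trigonometric_polynomial (\<lambda>w. f w * g w)"
proof -
  let ?p = "\<lambda>k w. \<Sum>i\<in>UNIV. of_int ((k :: int ^ 'a) $ i) * w $ i :: real"
  obtain K :: "(int ^ 'a) set" and a b where K: "finite K"
    "\<And>w. f w = (\<Sum>k\<in>K. a k * cos (?p k w) + b k * sin (?p k w))"
    using assms(1) unfolding trigonometric_polynomial_def by blast
  obtain L :: "(int ^ 'a) set" and a' b' where L: "finite L"
    "\<And>w. g w = (\<Sum>k\<in>L. a' k * cos (?p k w) + b' k * sin (?p k w))"
    using assms(2) unfolding trigonometric_polynomial_def by blast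
  have p: "?p (k + l) w = ?p k w + ?p l w" "?p (k - l) w = ?p k w - ?p l w" for k l w
    by (simp_all add: algebra_simps sum.distrib sum_subtractf)
  \<comment> \<open>The product-to-sum formulas turn harmonics with frequencies \<open>k\<close> and
    \<open>l\<close> into harmonics with frequencies \<open>k + l\<close> and
    \<open>k - l\<close>.\<close>
  have "(\<lambda>w. f w * g w) = (\<lambda>w. \<Sum>k\<in>K. \<Sum>l\<in>L.
      ((a k * a' l - b k * b' l) / 2 * cos (?p (k + l) w) + (a k * b' l + b k * a' l) / 2 * sin (?p (k + l) w))
    + ((a k * a' l + b k * b' l) / 2 * cos (?p (k - l) w) + (b k * a' l - a k * b' l) / 2 * sin (?p (k - l) w)))"
    unfolding K(2) L(2) sum_product p cos_add cos_diff sin_add sin_diff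
    by (intro ext sum.cong refl) (simp add: field_simps)
  then show ?thesis
    by (simp only:) (intro K(1) L(1) trigonometric_polynomial_sum trigonometric_polynomial_add trigonometric_polynomial_harmonic)
qed

lemma trigonometric_polynomial_sin: "trigonometric_polynomial (\<lambda>w. sin (w $ i))"
proof -
  have "(\<Sum>j\<in>UNIV. of_int ((axis i 1 :: int ^ 'a) $ j) * w $ j) = w $ i" for w :: "real ^ 'a"
    by (simp add: axis_def if_distrib if_distribR cong: if_cong)
  then show ?thesis
    using trigonometric_polynomial_harmonic[of 0 "axis i 1" 1] by simp
qed

section \<open>Recurrence\<close>

text \<open>
  By simultaneous Diophantine approximation the motion \<open>\<theta> + t \<omega>\<close> returns,
  modulo the periods, arbitrarily close to its starting point at times \<open>\<ge> 1\<close>.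
\<close>

lemma conditionally_periodic_derivative_zero:
  fixes g :: "'j::euclidean_space \<Rightarrow> real"
  assumes J: "J \<subseteq> Basis" and cont: "continuous_on UNIV g"
    and per: "\<And>\<theta> \<theta>'. (\<forall>b\<in>J. cis (\<theta> \<bullet> b) = cis (\<theta>' \<bullet> b)) \<Longrightarrow> g \<theta> = g \<theta>'"
    and der: "\<And>\<theta>. ((\<lambda>t. g (\<theta> + t *\<^sub>R \<omega>)) has_real_derivative D \<theta>) (at 0)"
    and nonneg: "\<And>\<theta>. 0 \<le> D \<theta>"
  shows "D \<theta> = 0"
proof -
  have finJ: "finite J"
    using J finite_Basis finite_subset by blast
  have der_t: "((\<lambda>t. g (\<theta> + t *\<^sub>R \<omega>)) has_real_derivative D (\<theta> + t *\<^sub>R \<omega>)) (at t)" for \<theta> t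
    using der[of "\<theta> + t *\<^sub>R \<omega>"] DERIV_shift[of "\<lambda>t. g (\<theta> + t *\<^sub>R \<omega>)" _ 0 t]
    by (simp add: algebra_simps)
  have mono: "g (\<theta> + t *\<^sub>R \<omega>) \<le> g (\<theta> + u *\<^sub>R \<omega>)" if "t \<le> u" for \<theta> t u
    using that der_t nonneg by (intro DERIV_nonneg_imp_nondecreasing[of t u "\<lambda>t. g (\<theta> + t *\<^sub>R \<omega>)"]) blast+
  \<comment> \<open>Times up to 1 suffice: the return time found below is a positive integer, so
    monotonicity carries the estimate from there back to \<open>t\<close>.\<close>
  have le: "g (\<theta> + t *\<^sub>R \<omega>) \<le> g \<theta>" if "t \<le> 1" for \<theta> t
  proof (rule field_le_epsilon)
    fix \<epsilon> :: real
    assume "0 < \<epsilon>"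
    then obtain \<delta> where \<delta>: "0 < \<delta>" "\<And>x. dist x \<theta> < \<delta> \<Longrightarrow> dist (g x) (g \<theta>) < \<epsilon>"
      using cont unfolding continuous_on_iff by (metis UNIV_I)
    obtain h where h: "bij_betw h {..<card J} J"
      using finJ ex_bij_betw_nat_finite[OF finJ] by (auto simp: atLeast0LessThan)
    \<comment> \<open>\<open>M\<close> makes the total phase error
      \<open>2 * pi * card J / M\<close> smaller than \<open>\<delta>\<close>; the summand 1 keeps
      \<open>M\<close> positive also for empty \<open>J\<close>.\<close>
    obtain M :: nat where M: "2 * pi * (real (card J) + 1) / \<delta> < real M"
      using reals_Archimedean2 by blast
    have M0: "0 < M"
    proof -
      have "0 < 2 * pi * (real (card J) + 1) / \<delta>"
        using \<delta>(1) by simp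
      then show ?thesis using M by linarith
    qed
    obtain m r where m: "0 < m"
      "\<And>i. i < card J \<Longrightarrow> \<bar>of_int m * (\<omega> \<bullet> h i / (2 * pi)) - of_int (r i)\<bar> < 1 / real M"
      using Dirichlet_approx_simult[OF M0, where n = "card J" and \<theta> = "\<lambda>i. \<omega> \<bullet> h i / (2 * pi)"] by metis
    \<comment> \<open>\<open>c b\<close> is the phase error of coordinate \<open>b\<close> at time
      \<open>m\<close>, reduced by a multiple of \<open>2 * pi\<close>. \<open>\<tau>\<close>
      collects these errors, so the motion at time \<open>m\<close> is at the same point of the
      torus as \<open>\<theta> + \<tau>\<close>.\<close>
    define c where "c b = of_int m * (\<omega> \<bullet> b) - 2 * pi * of_int (r (inv_into {..<card J} h b))" for b
    define \<tau> where "\<tau> = (\<Sum>b\<in>J. c b *\<^sub>R b)"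
    have c: "\<bar>c b\<bar> \<le> 2 * pi / real M" if "b \<in> J" for b
    proof -
      define i where "i = inv_into {..<card J} h b"
      have i: "i < card J" "h i = b"
        using h that unfolding i_def bij_betw_def
        by (metis inv_into_into lessThan_iff, metis f_inv_into_f)
      have "c b = 2 * pi * (of_int m * (\<omega> \<bullet> h i / (2 * pi)) - of_int (r i))"
        by (simp add: c_def i(2) flip: i_def) (simp add: field_simps)
      then have "\<bar>c b\<bar> = 2 * pi * \<bar>of_int m * (\<omega> \<bullet> h i / (2 * pi)) - of_int (r i)\<bar>"
        by (simp add: abs_mult)
      also have "\<dots> \<le> 2 * pi * (1 / real M)"
        using m(2)[OF i(1)] by (intro mult_left_mono) auto
      finally show ?thesis by simp
    qed
    have "norm \<tau> \<le> (\<Sum>b\<in>J. norm (c b *\<^sub>R b))"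
      unfolding \<tau>_def by (rule norm_sum)
    also have "\<dots> \<le> (\<Sum>b\<in>J. 2 * pi / real M)"
      using J c by (intro sum_mono) (auto simp: subset_iff)
    also have "\<dots> = 2 * pi * real (card J) / real M"
      by simp
    also have "\<dots> < \<delta>"
    proof -
      have "2 * pi * (real (card J) + 1) < real M * \<delta>"
        using M \<delta>(1) by (simp add: field_simps)
      then have "2 * pi * real (card J) < real M * \<delta>"
        using pi_gt_zero unfolding distrib_left by linarith
      then show ?thesis using M0 by (simp add: field_simps)
    qed
    finally have "g (\<theta> + \<tau>) < g \<theta> + \<epsilon>"
      using \<delta>(2)[of "\<theta> + \<tau>"] by (simp add: dist_norm)
    moreover have "g (\<theta> + of_int m *\<^sub>R \<omega>) = g (\<theta> + \<tau>)"
    proof (rule per, rule ballI)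
      fix b
      assume b: "b \<in> J"
      have "\<tau> \<bullet> b = (\<Sum>b'\<in>J. c b' * (b' \<bullet> b))"
        by (simp add: \<tau>_def inner_sum_left)
      also have "\<dots> = (\<Sum>b'\<in>J. if b' = b then c b else 0)"
        using b J by (intro sum.cong refl) (simp add: inner_Basis subset_eq)
      also have "\<dots> = c b" using b finJ by simp
      finally have "(\<theta> + of_int m *\<^sub>R \<omega>) \<bullet> b
          = (\<theta> + \<tau>) \<bullet> b + 2 * pi * of_int (r (inv_into {..<card J} h b))"
        by (simp add: c_def inner_add_left)
      then show "cis ((\<theta> + of_int m *\<^sub>R \<omega>) \<bullet> b) = cis ((\<theta> + \<tau>) \<bullet> b)"
        by (simp flip: cis_mult) 
    qed
    moreover have "g (\<theta> + t *\<^sub>R \<omega>) \<le> g (\<theta> + of_int m *\<^sub>R \<omega>)"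
      using m(1) \<open>t \<le> 1\<close> by (intro mono) linarith
    ultimately show "g (\<theta> + t *\<^sub>R \<omega>) \<le> g \<theta> + \<epsilon>" by simp
  qed
  \<comment> \<open>Applying \<open>le\<close> from \<open>\<theta>\<close> with time
    \<open>t\<close> and from \<open>\<theta> + t *\<^sub>R \<omega>\<close> with time
    \<open>-t\<close> gives both inequalities, so \<open>g\<close> is locally constant along the
    orbit.\<close>
  have "g (\<theta> + 0 *\<^sub>R \<omega>) = g (\<theta> + t *\<^sub>R \<omega>)" if "\<bar>t\<bar> < 1" for t
    using le[of t \<theta>] le[of "-t" "\<theta> + t *\<^sub>R \<omega>"] that
    by (intro antisym) (auto simp: algebra_simps)
  then show ?thesis
    using DERIV_local_const[OF der[of \<theta>], of 1] by simp
qed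

section \<open>Exact forms\<close>

text \<open>
  The integral of an exact form over the 2-torus spanned by two periodic directions vanishes.
\<close>

lemma exact_form_periodic:
  fixes \<pi> :: "'v::euclidean_space \<Rightarrow> 'p"
  assumes "exact_form \<pi> \<Omega>"
    and u: "\<And>x. \<pi> (x + (2 * pi) *\<^sub>R u) = \<pi> x" and v: "\<And>x. \<pi> (x + (2 * pi) *\<^sub>R v) = \<pi> x"
  shows "\<Omega> u v = 0"
proof -
  obtain \<alpha> :: "'p \<Rightarrow> 'v \<Rightarrow> real" where smooth: "\<And>v. smooth (\<lambda>x. \<alpha> (\<pi> x) v)"
    and \<Omega>: "\<And>x u v. \<Omega> u v = frechet_derivative (\<lambda>y. \<alpha> (\<pi> y) v) (at x) u
                       - frechet_derivative (\<lambda>y. \<alpha> (\<pi> y) u) (at x) v"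
    using assms(1) unfolding exact_form_def by blast
  \<comment> \<open>In these terms \<open>\<Omega> u v\<close> is \<open>A - B\<close>, a derivative
    along \<open>u\<close> minus a derivative along \<open>v\<close>.\<close>
  define a b where "a x = \<alpha> (\<pi> x) v" and "b x = \<alpha> (\<pi> x) u" for x
  define A B where "A x = frechet_derivative a (at x) u"
    and "B x = frechet_derivative b (at x) v" for x
  have smooth_ab: "smooth a" "smooth b"
    using smooth unfolding a_def b_def by blast+
  have AB: "A x = \<Omega> u v + B x" for x
    using \<Omega>[of u v x] unfolding A_def B_def a_def b_def by simp
  have contA: "continuous_on UNIV A" and contB: "continuous_on UNIV B"
    unfolding A_def B_def by (intro smooth_continuous_derivative smooth_ab)+
  have conta: "continuous_on UNIV a"
    using smooth_has_derivative[OF smooth_ab(1)]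
    by (intro continuous_at_imp_continuous_on ballI has_derivative_continuous) blast
  have dera: "((\<lambda>s. a (s *\<^sub>R u + t *\<^sub>R v)) has_real_derivative A (s *\<^sub>R u + t *\<^sub>R v)) (at s within T)" for s t T
  proof -
    have "((\<lambda>s. a (s *\<^sub>R u + t *\<^sub>R v)) has_derivative
        (\<lambda>h. frechet_derivative a (at (s *\<^sub>R u + t *\<^sub>R v)) (h *\<^sub>R u))) (at s within T)"
      by (rule has_derivative_compose[OF _ smooth_has_derivative[OF smooth_ab(1)]])
        (auto intro!: derivative_eq_intros)
    then show ?thesis
      unfolding has_field_derivative_def A_def
      using linear_scale[OF has_derivative_linear[OF smooth_has_derivative[OF smooth_ab(1)]]]
      by (simp add: mult_commute_abs)
  qed
  have derb: "((\<lambda>t. b (s *\<^sub>R u + t *\<^sub>R v)) has_real_derivative B (s *\<^sub>R u + t *\<^sub>R v)) (at t within T)" for s t T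
  proof -
    have "((\<lambda>t. b (s *\<^sub>R u + t *\<^sub>R v)) has_derivative
        (\<lambda>h. frechet_derivative b (at (s *\<^sub>R u + t *\<^sub>R v)) (h *\<^sub>R v))) (at t within T)"
      by (rule has_derivative_compose[OF _ smooth_has_derivative[OF smooth_ab(2)]])
        (auto intro!: derivative_eq_intros)
    then show ?thesis
      unfolding has_field_derivative_def B_def
      using linear_scale[OF has_derivative_linear[OF smooth_has_derivative[OF smooth_ab(2)]]]
      by (simp add: mult_commute_abs)
  qed
  \<comment> \<open>Integrating over the \<open>v\<close>-circle removes \<open>B\<close>, the
    derivative of a periodic function. This leaves \<open>G\<close> with the constant slope
    \<open>2 * pi * \<Omega> u v\<close>, which periodicity along \<open>u\<close> forces to be
    0.\<close>
  define G where "G s = integral (cbox 0 (2 * pi)) (\<lambda>t. a (s *\<^sub>R u + t *\<^sub>R v))" for s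
  have intA: "integral (cbox 0 (2 * pi)) (\<lambda>t. A (s *\<^sub>R u + t *\<^sub>R v)) = 2 * pi * \<Omega> u v" for s
  proof -
    have "((\<lambda>t. B (s *\<^sub>R u + t *\<^sub>R v)) has_integral
        (b (s *\<^sub>R u + (2 * pi) *\<^sub>R v) - b (s *\<^sub>R u + 0 *\<^sub>R v))) {0..2 * pi}"
      using derb by (intro fundamental_theorem_of_calculus)
        (auto simp flip: has_real_derivative_iff_has_vector_derivative)
    then have "((\<lambda>t. B (s *\<^sub>R u + t *\<^sub>R v)) has_integral 0) {0..2 * pi}"
      by (simp add: b_def v)
    from has_integral_add[OF has_integral_const_real[of "\<Omega> u v" 0 "2 * pi"] this]
    show ?thesis
      by (simp add: AB integral_unique)
  qed
  have "(G has_real_derivative 2 * pi * \<Omega> u v) (at s)" for s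
    unfolding G_def intA[of s, symmetric]
  proof (rule leibniz_rule_field_derivative)
    show "(\<lambda>t. a (s *\<^sub>R u + t *\<^sub>R v)) integrable_on cbox 0 (2 * pi)" for s
      by (intro integrable_continuous continuous_on_compose2[OF conta] continuous_intros) auto
    show "continuous_on (UNIV \<times> cbox 0 (2 * pi)) (\<lambda>(s, t). A (s *\<^sub>R u + t *\<^sub>R v))"
      unfolding case_prod_beta
      by (intro continuous_on_compose2[OF contA] continuous_intros) auto
  qed (use dera in auto)
  then have "G (2 * pi) - G 0 = (2 * pi - 0) * (2 * pi * \<Omega> u v)"
    using MVT2[of 0 "2 * pi" G "\<lambda>_. 2 * pi * \<Omega> u v"] by (auto)
  moreover have "G (2 * pi) = G 0"
    unfolding G_def a_def using u by (simp add: add.commute)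
  ultimately show ?thesis by simp
qed

text \<open>Provides the periodic directions to which \<open>exact_form_periodic\<close> is applied:
  the angles \<open>\<phi>\<close>, and those directions of the \<open>w\<close>-space along which
  \<open>\<kappa>\<close> is periodic.\<close>

lemma coords_periodic:
  assumes "\<And>w. \<kappa> (w + (2 * pi) *\<^sub>R fst u) = \<kappa> w" and "snd u = axis j 1 \<or> snd u = 0"
  shows "coords \<kappa> (x + (2 * pi) *\<^sub>R u) = coords \<kappa> x"
  using assms
  by (auto simp: coords_def case_prod_beta angles_def vec_eq_iff axis_def simp flip: cis_mult)

section \<open>Orthogonal complex structures\<close>

text \<open>\<open>J\<close> rotates by a right angle in each of the mutually orthogonal planes
  spanned by \<open>b\<close> and \<open>f b\<close>: it sends \<open>b\<close> to
  \<open>f b\<close> and \<open>f b\<close> to \<open>- b\<close>.\<close>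

lemma complex_structure_of_pairing:
  fixes L R :: "'v::euclidean_space set"
  assumes orth: "pairwise orthogonal (L \<union> R)" and norm: "\<And>b. b \<in> L \<union> R \<Longrightarrow> norm b = 1"
    and span: "span (L \<union> R) = UNIV" and disj: "L \<inter> R = {}" and f: "bij_betw f L R"
  obtains J :: "'v \<Rightarrow> 'v" where "linear J" "\<And>x. J (J x) = - x" "\<And>x y. J x \<bullet> y = - (x \<bullet> J y)"
    "\<And>b. b \<in> L \<Longrightarrow> J b = f b"
proof -
  have "independent (L \<union> R)"
    using orth norm by (intro pairwise_orthogonal_independent) force+
  then have fin: "finite L"
    using finiteI_independent by blast
  have fR: "f b \<in> R" if "b \<in> L" for b
    using f that by (auto simp: bij_betw_def)
  have finj: "f b = f c \<longleftrightarrow> b = c" if "b \<in> L" "c \<in> L" for b c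
    using f that by (auto simp: bij_betw_def inj_on_def)
  have fne: "f b \<noteq> c" "c \<noteq> f b" if "b \<in> L" "c \<in> L" for b c
    using fR disj that by blast+
  have inner: "b \<bullet> c = (if b = c then 1 else 0)" if "b \<in> L \<union> R" "c \<in> L \<union> R" for b c
    using orth norm that by (auto simp: pairwise_def orthogonal_def norm_eq_1)
  define J where "J u = (\<Sum>b\<in>L. (u \<bullet> b) *\<^sub>R f b - (u \<bullet> f b) *\<^sub>R b)" for u
  have lin: "linear J"
    unfolding J_def
    by (rule linearI) (simp_all add: inner_add_left scaleR_add_left scaleR_sum_right
      scaleR_diff_right sum.distrib sum_subtractf)
  have JL: "J c = f c" if c: "c \<in> L" for c
  proof -
    have "J c = (\<Sum>b\<in>L. if b = c then f c else 0)"
      unfolding J_def using c fR disj by (intro sum.cong) (auto simp: inner fne)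
    then show ?thesis using c fin by simp
  qed
  have JR: "J (f c) = - c" if c: "c \<in> L" for c
  proof -
    have "J (f c) = (\<Sum>b\<in>L. if b = c then - c else 0)"
      unfolding J_def using c fR disj by (intro sum.cong) (auto simp: inner finj fne)
    then show ?thesis using c fin by simp
  qed
  have "J (J x) = - x" for x
  proof (rule linear_eq_on_span[of "J \<circ> J" uminus "L \<union> R" x, unfolded o_apply])
    show "linear (\<lambda>x. J (J x))"
      using linear_compose[OF lin lin] by (simp add: o_def)
    show "J (J b) = - b" if "b \<in> L \<union> R" for b
      using that JL JR f linear_neg[OF lin] by (auto simp: bij_betw_def)
  qed (auto simp: span intro: linear_uminus)
  moreover have "J x \<bullet> y = - (x \<bullet> J y)" for x y
    unfolding J_def inner_sum_left inner_sum_right sum_negf[symmetric]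
    by (intro sum.cong) (auto simp: inner_diff_left inner_diff_right inner_commute)
  ultimately show thesis
    using that lin JL by blast
qed

lemma even_split:
  assumes "finite A" "even (card A)"
  obtains B C f where "A = B \<union> C" "B \<inter> C = {}" "bij_betw f B C"
proof -
  obtain B where B: "B \<subseteq> A" "card B = card A div 2"
    using obtain_subset_with_card_n[of "card A div 2" A] by auto
  then have "card (A - B) = card B"
    using assms by (auto simp: card_Diff_subset finite_subset elim!: evenE)
  moreover have "finite B" "finite (A - B)"
    using assms(1) B(1) finite_subset by auto
  ultimately obtain f where "bij_betw f B (A - B)"
    by (metis finite_same_card_bij)
  then show thesis
    using that[of B "A - B" f] B(1) by blast
qed

text \<open>Used to keep a distinguished element in a choice of prescribed size: the direction
  \<open>e\<close> among the paired directions, and later the index \<open>q\<close> in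
  \<open>Z\<close>.\<close>

lemma obtain_subset_containing:
  assumes "finite A" "a \<in> A" "1 \<le> k" "k \<le> card A"
  obtains B where "B \<subseteq> A" "a \<in> B" "card B = k"
proof -
  obtain C where C: "C \<subseteq> A - {a}" "card C = k - 1"
    using obtain_subset_with_card_n[of "k - 1" "A - {a}"] assms by (auto simp: diff_le_mono)
  moreover have "finite C"
    using C(1) assms(1) finite_subset by blast
  moreover have "a \<notin> C" using C(1) by blast
  ultimately show thesis
    using that[of "insert a C"] assms by auto
qed

text \<open>
  \<open>k\<close> directions of the second factor, one of them being \<open>e\<close>, are paired with directions of the first
  factor; the remaining directions of each factor are paired among themselves.
\<close>

lemma obtain_complex_structure:
  fixes e :: "real ^ 'n"
  assumes e: "norm e = 1" and k: "1 \<le> k" "k \<le> CARD('n)" "k + 1 \<le> CARD('w::finite)"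
    and even: "even (CARD('n) - k)" "even (CARD('w) - k)"
  obtains J :: "(real ^ 'w) \<times> (real ^ 'n) \<Rightarrow> (real ^ 'w) \<times> (real ^ 'n)" and p\<^sub>0 p q
  where "linear J" "\<And>x. J (J x) = - x" "\<And>x y. J x \<bullet> y = - (x \<bullet> J y)"
    "J (axis p\<^sub>0 1, 0) = (0, e)" "J (axis q 1, 0) = (axis p 1, 0)"
    "k = CARD('n) \<Longrightarrow> (\<And>\<phi>. snd (J (0, \<phi>)) = 0)"
    "k < CARD('n) \<Longrightarrow> (\<exists>\<phi>. snd (J (0, \<phi>)) \<noteq> 0)"
proof -
  obtain D where D: "e \<in> D" "pairwise orthogonal D" "\<And>x. x \<in> D \<Longrightarrow> norm x = 1"
    "independent D" "card D = DIM(real ^ 'n)" "span D = UNIV"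
    using vector_in_orthonormal_basis[OF e] by metis
  define W :: "((real ^ 'w) \<times> (real ^ 'n)) set" where "W = range (\<lambda>i. (axis i 1, 0))"
  define F :: "((real ^ 'w) \<times> (real ^ 'n)) set" where "F = Pair 0 ` D"
  have "finite D"
    using D(4) finiteI_independent by blast
  have finW: "finite W" and finF: "finite F"
    using \<open>finite D\<close> by (simp_all add: W_def F_def)
  have cardW: "card W = CARD('w)"
    unfolding W_def by (rule card_image) (auto simp: inj_on_def axis_eq_axis)
  have cardF: "card F = CARD('n)"
    unfolding F_def using D(5) by (subst card_image) (auto simp: inj_on_def)
  have WF: "W \<inter> F = {}"
    using D(3) by (force simp: W_def F_def axis_eq_0_iff)
  \<comment> \<open>\<open>A\<close> and \<open>B\<close> hold the \<open>k\<close> directions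
    paired across the two factors. The partner of \<open>(0, e)\<close> will give the index
    \<open>p\<^sub>0\<close>.\<close>
  obtain A where A: "A \<subseteq> W" "card A = k"
    using obtain_subset_with_card_n[of k W] k cardW by auto
  obtain B where B: "B \<subseteq> F" "(0, e) \<in> B" "card B = k"
    using obtain_subset_containing[of F "(0, e)" k] k cardF finF D(1) F_def by auto
  have finA: "finite A" and finB: "finite B"
    using A B finW finF finite_subset by blast+
  obtain g where g: "bij_betw g A B"
    using finite_same_card_bij[OF finA finB] A B by auto
  have "even (card (W - A))" "even (card (F - B))"
    using even A B finA finB by (simp_all add: card_Diff_subset cardW cardF)
  then obtain E1 E2 h F1 F2 j where E: "W - A = E1 \<union> E2" "E1 \<inter> E2 = {}" "bij_betw h E1 E2"
    and Fs: "F - B = F1 \<union> F2" "F1 \<inter> F2 = {}" "bij_betw j F1 F2"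
    using even_split finW finF by (metis finite_Diff)
  define L R f where "L = A \<union> (E1 \<union> F1)" and "R = B \<union> (E2 \<union> F2)"
    and "f x = (if x \<in> A then g x else if x \<in> E1 then h x else j x)" for x
  have disj: "A \<inter> B = {}" "A \<inter> E1 = {}" "A \<inter> E2 = {}" "A \<inter> F1 = {}" "A \<inter> F2 = {}"
    "B \<inter> E1 = {}" "B \<inter> E2 = {}" "B \<inter> F1 = {}" "B \<inter> F2 = {}" "E1 \<inter> F1 = {}" "E1 \<inter> F2 = {}"
    "E2 \<inter> F1 = {}" "E2 \<inter> F2 = {}"
    using A(1) B(1) E(1) Fs(1) WF by blast+
  have LR: "L \<union> R = W \<union> F"
    using A(1) B(1) E(1) Fs(1) unfolding L_def R_def by blast
  have fA: "bij_betw f A B"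
    using g by (subst bij_betw_cong[of _ f g]) (auto simp: f_def)
  have fE: "bij_betw f E1 E2"
    using E(3) disj by (subst bij_betw_cong[of _ f h]) (auto simp: f_def)
  have fF: "bij_betw f F1 F2"
    using Fs(3) disj by (subst bij_betw_cong[of _ f j]) (auto simp: f_def)
  have f: "bij_betw f L R"
    unfolding L_def R_def using disj fA fE fF by (intro bij_betw_combine) auto
  have disj_LR: "L \<inter> R = {}"
    using disj E(2) Fs(2) unfolding L_def R_def by (simp add: Int_Un_distrib Int_Un_distrib2 Int_commute)
  have "pairwise orthogonal (W \<union> F)"
    using D(2) by (auto simp: W_def F_def pairwise_def orthogonal_def inner_axis_axis split: if_splits) metis
  moreover have "norm b = 1" if "b \<in> W \<union> F" for b
    using that D(3) by (auto simp: W_def F_def norm_Pair)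
  moreover have "span (W \<union> F) = UNIV"
  proof -
    have "Pair 0 \<phi> \<in> span (W \<union> F)" for \<phi>
    proof -
      have "Pair 0 \<phi> \<in> Pair 0 ` span D" using D(6) by simp
      also have "\<dots> = span F"
        unfolding F_def by (rule linear_span_image[symmetric]) (auto intro: linearI)
      finally show ?thesis using span_mono[of F "W \<union> F"] by auto
    qed
    moreover have "(w, 0) \<in> span (W \<union> F)" for w
    proof -
      have "(w, 0) = (\<Sum>i\<in>UNIV. (w $ i) *\<^sub>R (axis i 1, 0 :: real ^ 'n))"
        by (auto simp: prod_eq_iff fst_sum snd_sum vec_eq_iff axis_def if_distrib cong: if_cong)
      also have "\<dots> \<in> span (W \<union> F)"
        by (intro span_sum span_scale span_base) (auto simp: W_def)
      finally show ?thesis .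
    qed
    moreover have "(w, \<phi>) = (w, 0) + (0, \<phi>)" for w :: "real ^ 'w" and \<phi> :: "real ^ 'n"
      by simp
    ultimately show ?thesis
      by (metis UNIV_eq_I span_add surj_pair)
  qed
  ultimately obtain J where J: "linear J" "\<And>x. J (J x) = - x" "\<And>x y. J x \<bullet> y = - (x \<bullet> J y)"
    "\<And>b. b \<in> L \<Longrightarrow> J b = f b"
    using complex_structure_of_pairing[of L R f] LR disj_LR f by metis
  obtain a where a: "a \<in> A" "f a = (0, e)"
    using fA B(2) unfolding bij_betw_def by (metis imageE)
  then obtain p\<^sub>0 where "a = (axis p\<^sub>0 1, 0)"
    using A(1) by (auto simp: W_def)
  then have 1: "J (axis p\<^sub>0 1, 0) = (0, e)"
    using J(4)[of a] a L_def by auto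
  \<comment> \<open>Since \<open>k < CARD('w)\<close>, some directions of the \<open>w\<close>-space
    are left over and paired with each other; one such pair gives \<open>q\<close> and
    \<open>p\<close>.\<close>
  have "card (W - A) \<noteq> 0"
    using k A(2) finA A(1) by (simp add: card_Diff_subset cardW)
  then have "E1 \<noteq> {}"
    using E(1,3) by (auto simp: bij_betw_def)
  then obtain b where b: "b \<in> E1" "f b \<in> E2"
    using fE by (auto simp: bij_betw_def)
  then have "b \<in> W" "f b \<in> W" using E(1) by auto
  then obtain q p where "b = (axis q 1, 0)" "f b = (axis p 1, 0)"
    by (auto simp: W_def)
  then have 2: "J (axis q 1, 0) = (axis p 1, 0)"
    using J(4)[of b] b L_def by auto
  have 3: "snd (J (0, \<phi>)) = 0" if "k = CARD('n)" for \<phi>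
  proof -
    \<comment> \<open>Every direction of the second factor is now the partner of a
      \<open>w\<close>-direction, so \<open>J\<close> maps it back into the
      \<open>w\<close>-space.\<close>
    have "B = F"
      using that B finF cardF card_subset_eq by metis
    have "linear (\<lambda>\<phi>. snd (J (0, \<phi>)))"
      using linear_compose[OF _ linear_compose[OF J(1) linear_snd], of "Pair 0"]
      by (simp add: o_def linear_iff)
    then show ?thesis
    proof (rule linear_eq_0_on_span[of _ D])
      fix x
      assume "x \<in> D"
      then obtain a where a: "a \<in> A" "f a = (0, x)"
        using fA \<open>B = F\<close> unfolding bij_betw_def F_def by (metis image_iff)
      then have "J (0, x) = - a"
        using J(2)[of a] J(4)[of a] L_def by auto
      then show "snd (J (0, x)) = 0"
        using A(1) a(1) by (auto simp: W_def)
    qed (simp add: D(6))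
  qed
  have 4: "\<exists>\<phi>. snd (J (0, \<phi>)) \<noteq> 0" if "k < CARD('n)"
  proof -
    \<comment> \<open>A leftover pair in the second factor: \<open>J\<close> sends one of its unit
      vectors to the other, inside the \<open>\<phi>\<close>-space.\<close>
    have "card (F - B) \<noteq> 0"
      using that B finB by (simp add: card_Diff_subset cardF)
    then have "F1 \<noteq> {}"
      using Fs(1,3) by (auto simp: bij_betw_def)
    then obtain b where b: "b \<in> F1" "f b \<in> F2"
      using fF by (auto simp: bij_betw_def)
    then have "b \<in> F" "f b \<in> F" using Fs(1) by auto
    then obtain x y where "b = (0, x)" "f b = (0, y)" "y \<in> D"
      by (auto simp: F_def)
    moreover have "J b = f b"
      using J(4) b L_def by auto
    ultimately show ?thesis
      using D(3) by (metis norm_zero snd_conv zero_neq_one)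
  qed
  show thesis
    by (rule that[OF J(1-3) 1 2 3 4])
qed

section \<open>Hamiltonian systems with a monotone coordinate\<close>

text \<open>
  \<open>s\<close> is the identity on \<open>\<real>\<close> and the sine on \<open>\<real>/2\<pi>\<int>\<close>, so that both kinds of phase space can be
  treated at once.
\<close>

locale coordinate_map =
  fixes \<kappa> :: "real ^ 'w \<Rightarrow> 'b::topological_space" and s s' :: "real \<Rightarrow> real"
  assumes \<kappa>_eq_iff: "\<kappa> w = \<kappa> w' \<longleftrightarrow> (\<forall>i. s (w $ i) = s (w' $ i) \<and> s' (w $ i) = s' (w' $ i))"
    and s_deriv: "(s has_real_derivative s' x) (at x)"
    and s_0: "s 0 = 0" and s'_0: "s' 0 = 1"
    and s_inj: "s x = s y \<Longrightarrow> s' x = s' y \<Longrightarrow> \<bar>x - y\<bar> < 1 \<Longrightarrow> x = y"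
    and s_zero: "s x = 0 \<Longrightarrow> 0 < s' x \<Longrightarrow> s' x = 1"
begin

lemma coords_eq_iff: "coords \<kappa> x = coords \<kappa> y \<longleftrightarrow> \<kappa> (fst x) = \<kappa> (fst y) \<and> angles (snd x) = angles (snd y)"
  by (simp add: coords_def case_prod_beta)

text \<open>By \<open>s_inj\<close> the fibres of \<open>\<kappa>\<close> are discrete, so the
  \<open>w\<close>-components of a curve in the torus are constant near time 0 by continuity and
  have zero velocity. Straight lines realise every vertical velocity.\<close>

lemma tangent_space_torus:
  assumes "y \<in> {\<kappa> w} \<times> torus"
  shows "tangent_space (coords \<kappa>) ({\<kappa> w} \<times> torus) y = {0} \<times> UNIV"
proof (intro set_eqI iffI)
  fix v
  assume "v \<in> tangent_space (coords \<kappa>) ({\<kappa> w} \<times> torus) y"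
  then obtain \<gamma> where \<gamma>: "\<And>t. coords \<kappa> (\<gamma> t) \<in> {\<kappa> w} \<times> torus"
    "(\<gamma> has_vector_derivative v) (at 0)"
    unfolding tangent_space_def by blast
  have "fst v $ i = 0" for i
  proof -
    have bl: "bounded_linear (\<lambda>x :: (real ^ 'w) \<times> (real ^ 'a). fst x $ i)"
      using bounded_linear_compose[OF bounded_linear_vec_nth bounded_linear_fst] .
    have d: "((\<lambda>t. fst (\<gamma> t) $ i) has_real_derivative fst v $ i) (at 0)"
      using bounded_linear.has_vector_derivative[OF bl \<gamma>(2)]
      by (simp add: has_real_derivative_iff_has_vector_derivative)
    then have "isCont (\<lambda>t. fst (\<gamma> t) $ i) 0"
      by (rule DERIV_isCont)
    then obtain \<delta> where \<delta>: "0 < \<delta>"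
      "\<And>t. dist t 0 < \<delta> \<Longrightarrow> dist (fst (\<gamma> t) $ i) (fst (\<gamma> 0) $ i) < 1"
      unfolding continuous_at_eps_delta by (metis zero_less_one)
    have "fst (\<gamma> 0) $ i = fst (\<gamma> t) $ i" if "\<bar>0 - t\<bar> < \<delta>" for t
    proof -
      have "\<kappa> (fst (\<gamma> 0)) = \<kappa> (fst (\<gamma> t))"
        using \<gamma>(1)[of 0] \<gamma>(1)[of t] by (simp add: coords_def case_prod_beta)
      then show ?thesis
        using \<delta>(2)[of t] that s_inj[of "fst (\<gamma> 0) $ i" "fst (\<gamma> t) $ i"]
        by (auto simp: \<kappa>_eq_iff dist_real_def abs_minus_commute)
    qed
    then show ?thesis
      using DERIV_local_const[OF d \<delta>(1)] by blast
  qed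
  then show "v \<in> {0} \<times> UNIV"
    by (cases v) (simp add: vec_eq_iff)
next
  fix v :: "(real ^ 'w) \<times> (real ^ 'a)"
  assume "v \<in> {0} \<times> UNIV"
  then have v: "fst v = 0" by auto
  obtain \<phi> where y: "y = coords \<kappa> (w, \<phi>)"
    using assms by (auto simp: coords_def)
  have "smooth (\<lambda>t. (w, \<phi>) + t *\<^sub>R v)"
    by (intro smooth_affine) (auto intro: linearI simp: algebra_simps)
  moreover have "((\<lambda>t. (w, \<phi>) + t *\<^sub>R v) has_vector_derivative v) (at 0)"
    by (auto intro!: derivative_eq_intros)
  ultimately show "v \<in> tangent_space (coords \<kappa>) ({\<kappa> w} \<times> torus) y"
    unfolding tangent_space_def using y v
    by (intro CollectI exI[of _ "\<lambda>t. (w, \<phi>) + t *\<^sub>R v"]) (auto simp: coords_def case_prod_beta)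
qed

end

text \<open>\<open>p\<close> and \<open>q\<close> index conjugate coordinates, and
  \<open>r *\<^sub>R e\<close> is the frequency vector to be realised on \<open>w = 0\<close>.
  \<open>Z\<close> lists the coordinates that vanish on the family; a nonempty \<open>Z\<close>
  contains \<open>q\<close> because the driving term of the Hamiltonian has the factor
  \<open>s (w $ q)\<close>.\<close>

locale monotone_system = coordinate_map \<kappa> s s'
  for \<kappa> :: "real ^ 'w \<Rightarrow> 'b::topological_space" and s s' +
  fixes J :: "(real ^ 'w) \<times> (real ^ 'n) \<Rightarrow> (real ^ 'w) \<times> (real ^ 'n)"
    and e :: "real ^ 'n" and p\<^sub>0 p q :: 'w and Z :: "'w set" and r :: real
  assumes J_linear: "linear J" and J_J: "J (J x) = - x" and J_skew: "J x \<bullet> y = - (x \<bullet> J y)"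
    and J_p\<^sub>0: "J (axis p\<^sub>0 1, 0) = (0, e)" and J_q: "J (axis q 1, 0) = (axis p 1, 0)"
    and Z: "Z = {} \<or> q \<in> Z"
begin

section \<open>The form, the Hamiltonian and its vector field\<close>

definition \<Omega> where "\<Omega> u v = J u \<bullet> v"

text \<open>The cube contributes the missing square \<open>(s (w $ q))\<^sup>2\<close> to the
  \<open>q\<close>-derivative, which becomes \<open>s' (w $ q)\<close> times a sum of squares over
  all of \<open>Z\<close>. The other derivatives of the second term keep the factor
  \<open>s (w $ q)\<close> and vanish on the family.\<close>

definition energy :: "real ^ 'w \<Rightarrow> real" where
  "energy w = r * s (w $ p\<^sub>0) +
     (if Z = {} then 0 else s (w $ q) ^ 3 / 3 + s (w $ q) * (\<Sum>i\<in>Z - {q}. (s (w $ i))\<^sup>2))"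

definition grad :: "real ^ 'w \<Rightarrow> real ^ 'w" where
  "grad w = (r * s' (w $ p\<^sub>0)) *\<^sub>R axis p\<^sub>0 1 +
     (if Z = {} then 0 else (s' (w $ q) * (\<Sum>i\<in>Z. (s (w $ i))\<^sup>2)) *\<^sub>R axis q 1 +
       (\<Sum>i\<in>Z - {q}. (2 * s (w $ q) * s (w $ i) * s' (w $ i)) *\<^sub>R axis i 1))"

text \<open>\<open>inv \<kappa>\<close> picks an arbitrary representative \<open>w\<close>. The
  choice does not matter, because \<open>energy\<close> sees \<open>w\<close> only through
  \<open>s\<close>, whose values \<open>\<kappa>\<close> determines; for \<open>X\<close> the same
  holds with \<open>s\<close> and \<open>s'\<close>.\<close>

definition H :: "'b \<times> (complex ^ 'n) \<Rightarrow> real" where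
  "H x = energy (inv \<kappa> (fst x))"

definition X :: "'b \<times> (complex ^ 'n) \<Rightarrow> (real ^ 'w) \<times> (real ^ 'n)" where
  "X x = J (grad (inv \<kappa> (fst x)), 0)"

text \<open>For the sine, the condition on \<open>s'\<close> excludes the other zero, at
  \<open>pi\<close>, where the cosine is -1.\<close>

definition S :: "'b set" where
  "S = \<kappa> ` {w. \<forall>i\<in>Z. s (w $ i) = 0 \<and> s' (w $ i) = 1}"

lemma inv_\<kappa>: "s (inv \<kappa> (\<kappa> w) $ i) = s (w $ i)" "s' (inv \<kappa> (\<kappa> w) $ i) = s' (w $ i)"
  using \<kappa>_eq_iff[of "inv \<kappa> (\<kappa> w)" w] by (auto simp: f_inv_into_f)

lemma H_coords: "H (coords \<kappa> x) = energy (fst x)"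
  by (simp add: H_def energy_def coords_def case_prod_beta inv_\<kappa>)

lemma X_coords: "X (coords \<kappa> x) = J (grad (fst x), 0)"
  by (simp add: X_def grad_def coords_def case_prod_beta inv_\<kappa>)

lemma \<kappa>_in_S: "\<kappa> w \<in> S \<longleftrightarrow> (\<forall>i\<in>Z. s (w $ i) = 0 \<and> s' (w $ i) = 1)"
  unfolding S_def by (auto simp: \<kappa>_eq_iff)

text \<open>Skewness of \<open>J\<close> makes the form alternating; \<open>J u\<close> itself
  witnesses nondegeneracy, \<open>J\<close> being injective.\<close>

lemma symplectic: "symplectic_form \<Omega>"
  unfolding symplectic_form_def
proof (intro conjI allI impI)
  show "bilinear \<Omega>"
    unfolding bilinear_def \<Omega>_def
    by (intro conjI allI linearI)
      (simp_all only: inner_add_left inner_add_right linear_add[OF J_linear] linear_scale[OF J_linear]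
        inner_scaleR_left inner_scaleR_right real_scaleR_def)
  show "\<Omega> u u = 0" for u
    using J_skew[of u u] by (simp add: \<Omega>_def inner_commute)
  show "\<exists>v. \<Omega> u v \<noteq> 0" if "u \<noteq> 0" for u
  proof
    have "J u \<noteq> 0"
      using that J_J[of u] linear_0[OF J_linear] by auto
    then show "\<Omega> u (J u) \<noteq> 0" by (simp add: \<Omega>_def)
  qed
qed

lemma s_has_derivative: "((\<lambda>w :: real ^ 'w. s (w $ i)) has_derivative (\<lambda>y. s' (w $ i) * y $ i)) (at w)"
proof -
  have "((\<lambda>w :: real ^ 'w. s (w $ i)) has_derivative (\<lambda>y. s' (w $ i) * (y $ i))) (at w)"
    by (rule has_derivative_compose[where g = s and f = "\<lambda>w. w $ i"])
      (use s_deriv in \<open>auto simp: has_field_derivative_def intro!: bounded_linear_imp_has_derivative bounded_linear_vec_nth\<close>)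
  then show ?thesis .
qed

lemma energy_has_derivative: "(energy has_derivative (\<lambda>y. y \<bullet> grad w)) (at w)"
proof -
  have Z_sum: "(\<Sum>i\<in>Z. (s (w $ i))\<^sup>2) = (s (w $ q))\<^sup>2 + (\<Sum>i\<in>Z - {q}. (s (w $ i))\<^sup>2)" if "Z \<noteq> {}"
    using Z that by (simp add: sum.remove[of Z q])
  note [derivative_intros] = s_has_derivative
  show ?thesis
  proof (cases "Z = {}")
    case True
    then show ?thesis
      unfolding energy_def grad_def
      by (auto intro!: derivative_eq_intros simp: inner_axis algebra_simps)
  next
    case False
    show ?thesis
      unfolding energy_def grad_def Z_sum[OF False] if_not_P[OF False]
      by (auto intro!: derivative_eq_intros
          simp: inner_axis inner_add_right inner_sum_right algebra_simps power2_eq_square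
            sum_distrib_left sum_distrib_right sum.distrib)
  qed
qed

text \<open>Skewness and \<open>J (J x) = - x\<close> turn \<open>\<Omega> y (J g)\<close> into
  \<open>y \<bullet> g\<close>, so applying \<open>J\<close> to the gradient solves the defining
  equation.\<close>

lemma hamiltonian: "hamiltonian_vector_field (coords \<kappa>) \<Omega> H X"
  unfolding hamiltonian_vector_field_def
proof
  fix x
  have "\<Omega> y (X (coords \<kappa> x)) = y \<bullet> (grad (fst x), 0)" for y
    unfolding \<Omega>_def X_coords J_skew[of y] J_J by (simp add: inner_prod_def)
  then have "(\<lambda>y. \<Omega> y (X (coords \<kappa> x))) = (\<lambda>y. fst y \<bullet> grad (fst x))"
    by (simp add: inner_prod_def)
  moreover have "((\<lambda>x. energy (fst x)) has_derivative (\<lambda>y. fst y \<bullet> grad (fst x))) (at x)"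
    by (rule has_derivative_compose[OF _ energy_has_derivative]) (auto intro!: derivative_eq_intros)
  moreover have "H \<circ> coords \<kappa> = (\<lambda>x. energy (fst x))"
    by (simp add: fun_eq_iff H_coords)
  ultimately show "((H \<circ> coords \<kappa>) has_derivative (\<lambda>y. \<Omega> y (X (coords \<kappa> x)))) (at x)"
    by metis
qed

lemma grad_on_S:
  assumes "\<kappa> w \<in> S"
  shows "grad w = (r * s' (w $ p\<^sub>0)) *\<^sub>R axis p\<^sub>0 1"
proof (cases "Z = {}")
  case True
  then show ?thesis unfolding grad_def by simp
next
  case False
  then have "s (w $ q) = 0"
    using assms Z unfolding \<kappa>_in_S by blast
  moreover have "(\<Sum>i\<in>Z. (s (w $ i))\<^sup>2) = 0"
    using assms unfolding \<kappa>_in_S by simp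
  ultimately show ?thesis
    unfolding grad_def by simp
qed

lemma X_on_S:
  assumes "\<kappa> w \<in> S"
  shows "X (coords \<kappa> (w, \<phi>)) = (0, (r * s' (w $ p\<^sub>0)) *\<^sub>R e)"
  using linear_scale[OF J_linear, of "r * s' (w $ p\<^sub>0)" "(axis p\<^sub>0 1, 0)"]
  by (simp add: X_coords grad_on_S[OF assms] J_p\<^sub>0)

lemma grad_q:
  assumes "Z \<noteq> {}"
  shows "grad w $ q = s' (w $ q) * (\<Sum>i\<in>Z. (s (w $ i))\<^sup>2)"
proof -
  \<comment> \<open>\<open>J\<close> takes the two axes into different factors. Hence the term of
    the gradient along \<open>p\<^sub>0\<close> that carries \<open>r\<close> does not enter the
    \<open>q\<close>-component.\<close>
  have "p\<^sub>0 \<noteq> q"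
    using J_p\<^sub>0 J_q by (auto simp: axis_eq_0_iff)
  then show ?thesis
    using assms by (auto simp: grad_def axis_def if_distrib if_distribR cong: if_cong intro!: sum.neutral)
qed

text \<open>By skewness \<open>J\<close> can be moved onto \<open>axis p 1\<close>, which it sends
  to \<open>- axis q 1\<close>. This is the Hamilton equation for \<open>w $ p\<close>: its velocity
  is the \<open>q\<close>-derivative of the energy.\<close>

lemma fst_J_p: "fst (J (y, 0)) $ p = y $ q"
proof -
  have "J (axis p 1, 0) = - (axis q 1, 0)"
    using J_J[of "(axis q 1, 0)"] J_q by simp
  then show ?thesis
    using J_skew[of "(y, 0)" "(axis p 1, 0)"] by (simp add: inner_axis inner_prod_def)
qed

section \<open>Invariant tori and the analytic family they form\<close>

lemma frequency_vector_on_S: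
  assumes "\<kappa> w \<in> S"
  shows "has_frequency_vector \<kappa> X w ((r * s' (w $ p\<^sub>0)) *\<^sub>R e)"
  unfolding has_frequency_vector_def kronecker_parametrization_def
proof (intro conjI allI)
  have lin: "linear (Pair (0 :: real ^ 'w) :: real ^ 'n \<Rightarrow> _)"
    by (auto intro: linearI)
  have "((\<lambda>\<phi>. (w, \<phi>)) has_derivative Pair 0) (at \<phi>)" for \<phi> :: "real ^ 'n"
    by (auto intro!: derivative_eq_intros)
  then have fd: "frechet_derivative (\<lambda>\<phi>. (w, \<phi>)) (at \<phi>) = Pair 0" for \<phi> :: "real ^ 'n"
    using frechet_derivative_at by metis
  show "smooth (\<lambda>\<phi> :: real ^ 'n. (w, \<phi>))"
    using smooth_affine[OF lin, of "(w, 0)"] by simp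
  show "coords \<kappa> (w, \<theta>) = coords \<kappa> (w, \<theta>') \<longleftrightarrow> (\<forall>b\<in>Basis. cis (\<theta> \<bullet> b) = cis (\<theta>' \<bullet> b))"
    for \<theta> \<theta>' :: "real ^ 'n"
    by (auto simp: coords_def angles_def vec_eq_iff Basis_vec_def inner_axis)
  show "frechet_derivative (Pair w) (at \<theta>) v = 0 \<longleftrightarrow> (\<forall>b\<in>Basis. v \<bullet> b = 0)" for \<theta> v :: "real ^ 'n"
    unfolding fd by (auto simp: zero_prod_def euclidean_eq_iff[of v 0])
  show "frechet_derivative (Pair w) (at \<theta>) ((r * s' (w $ p\<^sub>0)) *\<^sub>R e) = X (coords \<kappa> (w, \<theta>))" for \<theta>
    unfolding fd by (simp add: X_on_S[OF assms])
qed

lemma kronecker_torus_on_S: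
  assumes "\<kappa> w \<in> S"
  shows "kronecker_torus (coords \<kappa>) X CARD('n) ({\<kappa> w} \<times> torus)"
  unfolding kronecker_torus_def kronecker_parametrization_def
proof (intro exI conjI allI)
  \<comment> \<open>\<open>kronecker_torus\<close> parametrizes by the whole coordinate space of the
    phase space; here the \<open>w\<close>-coordinates are the dummies, which \<open>?F\<close>
    discards.\<close>
  let ?J = "Pair 0 ` (Basis :: (real ^ 'n) set) :: ((real ^ 'w) \<times> (real ^ 'n)) set"
  let ?L = "\<lambda>x :: (real ^ 'w) \<times> (real ^ 'n). (0 :: real ^ 'w, snd x)"
  let ?F = "\<lambda>x :: (real ^ 'w) \<times> (real ^ 'n). (w, 0) + ?L x"
  let ?\<omega> = "(0 :: real ^ 'w, (r * s' (w $ p\<^sub>0)) *\<^sub>R e)"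
  show "?J \<subseteq> Basis"
    by (auto simp: Basis_prod_def)
  show "card ?J = CARD('n)"
    by (subst card_image) (auto simp: inj_on_def)
  have lin: "linear ?L"
    by (auto intro: linearI)
  have "(?F has_derivative ?L) (at x)" for x
    by (auto intro!: derivative_eq_intros)
  then have fd: "frechet_derivative ?F (at x) = ?L" for x
    using frechet_derivative_at by metis
  show "smooth ?F"
    by (rule smooth_affine[OF lin])
  show "coords \<kappa> (?F \<theta>) = coords \<kappa> (?F \<theta>') \<longleftrightarrow> (\<forall>b\<in>?J. cis (\<theta> \<bullet> b) = cis (\<theta>' \<bullet> b))" for \<theta> \<theta>'
    by (auto simp: coords_def angles_def vec_eq_iff Basis_vec_def inner_axis inner_prod_def)
  show "frechet_derivative ?F (at \<theta>) v = 0 \<longleftrightarrow> (\<forall>b\<in>?J. v \<bullet> b = 0)" for \<theta> v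
    unfolding fd by (auto simp: zero_prod_def inner_prod_def euclidean_eq_iff[of "snd v" 0])
  show "frechet_derivative ?F (at \<theta>) ?\<omega> = X (coords \<kappa> (?F \<theta>))" for \<theta>
    unfolding fd by (simp add: X_on_S[OF assms])
  have "coords \<kappa> (?F x) = (\<kappa> w, angles (snd x))" for x
    by (simp add: coords_def)
  then have "range (coords \<kappa> \<circ> ?F) = range (\<lambda>x :: (real ^ 'w) \<times> (real ^ 'n). (\<kappa> w, angles (snd x)))"
    by simp
  also have "\<dots> = {\<kappa> w} \<times> torus"
    by (force simp: image_iff)
  finally show "{\<kappa> w} \<times> torus = range (coords \<kappa> \<circ> ?F)" ..
qed

lemma kronecker_family:
  assumes "card Z + d = CARD('w)"
  shows "kronecker_family \<kappa> X d S"
  unfolding kronecker_family_def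
proof (intro conjI ballI)
  show "S \<subseteq> range \<kappa>"
    by (auto simp: S_def)
  show "kronecker_torus (coords \<kappa>) X CARD('n) ({x} \<times> torus)" if "x \<in> S" for x
    using that kronecker_torus_on_S by (auto simp: S_def)
  show "analytic_submanifold d (\<kappa> -` S)"
    unfolding analytic_submanifold_def
  proof
    fix x
    assume x: "x \<in> \<kappa> -` S"
    \<comment> \<open>Within distance 1 of \<open>x\<close>, \<open>s_inj\<close> reduces membership
      in \<open>S\<close> to \<open>y $ i = x $ i\<close> for \<open>i \<in> Z\<close>. Hence the
      translation taking \<open>x\<close> to 0 is a chart, with free coordinates
      \<open>- Z\<close>.\<close>
    let ?U = "ball x 1" and ?\<Phi> = "\<lambda>y. y + (- x)" and ?\<Psi> = "\<lambda>y. y + x"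
    have U: "open ?U" "x \<in> ?U" by simp_all
    have \<Phi>U: "open (?\<Phi> ` ?U)"
      using open_translation[of ?U "- x"] by (simp add: add.commute)
    have \<Psi>: "\<forall>y\<in>?U. ?\<Psi> (?\<Phi> y) = y" by simp
    have card: "card (- Z) = d"
      using assms by (simp add: Compl_eq_Diff_UNIV card_Diff_subset)
    have "y \<in> \<kappa> -` S \<longleftrightarrow> (\<forall>i. i \<notin> - Z \<longrightarrow> ?\<Phi> y $ i = 0)" if y: "y \<in> ?U" for y
    proof
      assume *: "y \<in> \<kappa> -` S"
      have "y $ i = x $ i" if "i \<in> Z" for i
      proof -
        have "\<bar>y $ i - x $ i\<bar> < 1"
          using component_le_norm_cart[of "y - x" i] y by (simp add: dist_norm norm_minus_commute)
        then show ?thesis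
          using that * x s_inj[of "y $ i" "x $ i"] by (simp add: \<kappa>_in_S)
      qed
      then show "\<forall>i. i \<notin> - Z \<longrightarrow> ?\<Phi> y $ i = 0" by simp
    next
      assume *: "\<forall>i. i \<notin> - Z \<longrightarrow> ?\<Phi> y $ i = 0"
      have "\<forall>i\<in>Z. s (x $ i) = 0 \<and> s' (x $ i) = 1"
        using x by (simp add: \<kappa>_in_S)
      moreover have "y $ i = x $ i" if "i \<in> Z" for i
        using * that by simp
      ultimately show "y \<in> \<kappa> -` S"
        by (simp add: \<kappa>_in_S)
    qed
    then show "\<exists>U \<Phi> \<Psi>. \<exists>I :: 'w set. open U \<and> x \<in> U \<and> open (\<Phi> ` U) \<and>
        \<Phi> real_analytic_on U \<and> \<Psi> real_analytic_on (\<Phi> ` U) \<and> (\<forall>y\<in>U. \<Psi> (\<Phi> y) = y) \<and> card I = d \<and>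
        (\<forall>y\<in>U. y \<in> \<kappa> -` S \<longleftrightarrow> (\<forall>i. i \<notin> I \<longrightarrow> \<Phi> y $ i = 0))"
      using U \<Phi>U \<Psi> card real_analytic_on_translation by blast
  qed
qed

text \<open>
  The observable \<open>s (w $ p)\<close> is nondecreasing along the flow as long as all \<open>s' (w $ i)\<close> are positive,
  and it is stationary only on \<open>S \<times> torus\<close>.
\<close>

lemma kronecker_torus_in_S:
  assumes "kronecker_torus (coords \<kappa>) X m T"
    and pos: "T \<subseteq> coords \<kappa> ` {x. \<forall>i. 0 < s' (fst x $ i)}"
  shows "T \<subseteq> S \<times> torus"
proof -
  obtain B \<omega> and F :: "(real ^ 'w) \<times> (real ^ 'n) \<Rightarrow> (real ^ 'w) \<times> (real ^ 'n)" where B: "B \<subseteq> Basis" and F: "kronecker_parametrization (coords \<kappa>) X B \<omega> F"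
    and T: "T = range (coords \<kappa> \<circ> F)"
    using assms(1) unfolding kronecker_torus_def by blast
  have F_der: "(F has_derivative frechet_derivative F (at \<theta>)) (at \<theta>)" for \<theta>
    using F smooth_has_derivative unfolding kronecker_parametrization_def by blast
  have F_\<omega>: "frechet_derivative F (at \<theta>) \<omega> = J (grad (fst (F \<theta>)), 0)" for \<theta>
    using F unfolding kronecker_parametrization_def by (metis X_coords)
  \<comment> \<open>\<open>pos\<close> may be witnessed by another representative of the same point,
    but \<open>s'\<close> depends only on the value of \<open>\<kappa>\<close>.\<close>
  have s'_pos: "0 < s' (fst (F \<theta>) $ i)" for \<theta> i
  proof -
    have "coords \<kappa> (F \<theta>) \<in> coords \<kappa> ` {x. \<forall>i. 0 < s' (fst x $ i)}"
      using pos T by auto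
    then show ?thesis
      by (auto simp: coords_eq_iff \<kappa>_eq_iff)
  qed
  have "\<kappa> (fst (F \<theta>)) \<in> S" for \<theta>
  proof (cases "Z = {}")
    case True
    then show ?thesis unfolding \<kappa>_in_S by simp
  next
    case False
    \<comment> \<open>\<open>D\<close> is the derivative of the observable \<open>g\<close> along
      the flow, by the chain rule with \<open>fst_J_p\<close> and \<open>grad_q\<close>; it is a
      product of positive factors and a sum of squares.\<close>
    define g where "g \<theta> = s (fst (F \<theta>) $ p)" for \<theta>
    define D where "D \<theta> = s' (fst (F \<theta>) $ p) * (s' (fst (F \<theta>) $ q) * (\<Sum>i\<in>Z. (s (fst (F \<theta>) $ i))\<^sup>2))" for \<theta>
    have g_der: "(g has_derivative (\<lambda>v. s' (fst (F \<theta>) $ p) * (fst (frechet_derivative F (at \<theta>) v) $ p))) (at \<theta>)" for \<theta>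
      unfolding g_def
      by (rule has_derivative_compose[OF has_derivative_fst[OF F_der] s_has_derivative])
    have "D \<theta> = 0"
    proof (rule conditionally_periodic_derivative_zero[OF B, of g \<omega>])
      show "continuous_on UNIV g"
        using g_der by (intro continuous_at_imp_continuous_on ballI has_derivative_continuous) blast
      show "g \<theta> = g \<theta>'" if "\<forall>b\<in>B. cis (\<theta> \<bullet> b) = cis (\<theta>' \<bullet> b)" for \<theta> \<theta>'
      proof -
        have "coords \<kappa> (F \<theta>) = coords \<kappa> (F \<theta>')"
          using F that unfolding kronecker_parametrization_def by blast
        then show ?thesis
          by (simp add: g_def coords_eq_iff \<kappa>_eq_iff)
      qed
      show "((\<lambda>t. g (\<theta> + t *\<^sub>R \<omega>)) has_real_derivative D \<theta>) (at 0)" for \<theta>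
      proof -
        have "((\<lambda>t. g (\<theta> + t *\<^sub>R \<omega>)) has_derivative
           (\<lambda>t. s' (fst (F (\<theta> + 0 *\<^sub>R \<omega>)) $ p) * (fst (frechet_derivative F (at (\<theta> + 0 *\<^sub>R \<omega>)) (t *\<^sub>R \<omega>)) $ p))) (at 0)"
          by (rule has_derivative_compose[OF _ g_der]) (auto intro!: derivative_eq_intros)
        moreover have "s' (fst (F \<theta>) $ p) * (fst (frechet_derivative F (at \<theta>) (t *\<^sub>R \<omega>)) $ p) = D \<theta> * t" for t
          using linear_scale[OF has_derivative_linear[OF F_der[of \<theta>]], of t \<omega>]
          by (simp add: F_\<omega> fst_J_p grad_q[OF False] D_def)
        ultimately show ?thesis
          by (simp add: has_field_derivative_def)
      qed
      show "0 \<le> D \<theta>" for \<theta>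
        unfolding D_def by (intro mult_nonneg_nonneg sum_nonneg zero_le_power2 less_imp_le[OF s'_pos])
    qed
    then have "(\<Sum>i\<in>Z. (s (fst (F \<theta>) $ i))\<^sup>2) = 0"
      using s'_pos[of \<theta> p] s'_pos[of \<theta> q] by (simp add: D_def)
    then have "\<forall>i\<in>Z. s (fst (F \<theta>) $ i) = 0"
      by (subst (asm) sum_nonneg_eq_0_iff) auto
    \<comment> \<open>A zero of \<open>s\<close> with positive \<open>s'\<close> has
      \<open>s' = 1\<close>, as membership in \<open>S\<close> demands.\<close>
    then show ?thesis
      using s_zero s'_pos by (auto simp: \<kappa>_in_S)
  qed
  then show ?thesis
    unfolding T by (auto simp: coords_def case_prod_beta)
qed

lemma zero_in_S: "\<kappa> 0 \<in> S"
  unfolding \<kappa>_in_S using s_0 s'_0 by simp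

lemma frequency_vector_zero: "has_frequency_vector \<kappa> X 0 (r *\<^sub>R e)"
  using frequency_vector_on_S[OF zero_in_S] unfolding zero_index s'_0 mult_1_right .

lemma S_eq_range:
  assumes "Z = {}"
  shows "S = range \<kappa>"
proof -
  have "{w :: real ^ 'w. \<forall>i\<in>Z. s (w $ i) = 0 \<and> s' (w $ i) = 1} = UNIV"
    using assms by auto
  then show ?thesis by (simp only: S_def)
qed

text \<open>With all coordinates in \<open>Z\<close> the set \<open>S\<close> is the point
  \<open>\<kappa> 0\<close>, so a Kronecker torus inside \<open>U\<close> lies in the given torus
  and, being nonempty, meets it. \<open>U\<close> is the whole phase space for the identity and a
  proper neighbourhood for the sine.\<close>

lemma isolating:
  assumes "Z = UNIV"
    and U: "U = coords \<kappa> ` {x. \<forall>i. 0 < s' (fst x $ i)}" "openin (top_of_set (range (coords \<kappa>))) U"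
  shows "isolating_neighbourhood (coords \<kappa>) X ({\<kappa> 0} \<times> torus) U"
  unfolding isolating_neighbourhood_def
proof (intro conjI notI)
  show "{\<kappa> 0} \<times> torus \<subseteq> U"
  proof
    fix y :: "'b \<times> (complex ^ 'n)"
    assume "y \<in> {\<kappa> 0} \<times> torus"
    then obtain \<phi> where "y = coords \<kappa> (0, \<phi>)" by (auto simp: coords_def)
    then show "y \<in> U" unfolding U(1) by (auto simp: s'_0)
  qed
  have "S \<subseteq> {\<kappa> 0}"
    unfolding S_def using assms(1) by (auto simp: \<kappa>_eq_iff s_0 s'_0)
  moreover assume "\<exists>m T'. kronecker_torus (coords \<kappa>) X m T' \<and> T' \<subseteq> U - {\<kappa> 0} \<times> torus"
  then obtain m T' where T': "kronecker_torus (coords \<kappa>) X m T'" "T' \<subseteq> U - {\<kappa> 0} \<times> torus"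
    by blast
  moreover have "T' \<subseteq> S \<times> torus"
    using T' by (intro kronecker_torus_in_S) (auto simp: U(1))
  moreover have "T' \<noteq> {}"
    using T'(1) by (auto simp: kronecker_torus_def)
  ultimately show False by blast
qed (rule U(2))

section \<open>Isotropic and atropic tori\<close>

lemma strictly_isotropic_on_S:
  assumes "x \<in> S" and "CARD('n) < CARD('w)" and "\<And>\<phi>. snd (J (0, \<phi>)) = 0"
  shows "strictly_isotropic (coords \<kappa>) \<Omega> ({x} \<times> torus)"
proof -
  obtain w where x: "x = \<kappa> w" using assms(1) unfolding S_def by blast
  have "dim ({0 :: real ^ 'w} \<times> (UNIV :: (real ^ 'n) set)) = CARD('n)"
    by (subst dim_Times) (auto simp: subspace_0)
  moreover have "{0} \<times> UNIV \<subseteq> skew_complement \<Omega> ({0} \<times> UNIV)"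
    unfolding skew_complement_def \<Omega>_def using assms(3) by (auto simp: inner_prod_def)
  ultimately show ?thesis
    unfolding x strictly_isotropic_def isotropic_def using assms(2)
    by (simp add: tangent_space_torus)
qed

lemma atropic_on_S:
  assumes "x \<in> S" and "snd (J (0, \<phi>)) \<noteq> 0"
  shows "atropic (coords \<kappa>) \<Omega> ({x} \<times> torus)"
proof -
  obtain w where x: "x = \<kappa> w" using assms(1) unfolding S_def by blast
  define y where "y = coords \<kappa> (w, 0 :: real ^ 'n)"
  have y: "y \<in> {\<kappa> w} \<times> torus"
    by (auto simp: y_def coords_def)
  \<comment> \<open>A vertical vector paired with the vertical part of its own image under
    \<open>J\<close> gives the squared norm of that part.\<close>
  have "\<Omega> (0, \<phi>) (0, snd (J (0, \<phi>))) \<noteq> 0"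
    using assms(2) by (simp add: \<Omega>_def inner_prod_def)
  then have "\<not> {0} \<times> UNIV \<subseteq> skew_complement \<Omega> ({0} \<times> UNIV)"
    unfolding skew_complement_def by blast
  then have not_isotropic: "\<not> isotropic (coords \<kappa>) \<Omega> ({\<kappa> w} \<times> torus)"
    unfolding isotropic_def tangent_space_torus[OF y, symmetric] using y by blast
  \<comment> \<open>\<open>J\<close> sends the \<open>q\<close>-axis into the
    \<open>w\<close>-space, so this axis is skew-orthogonal to the torus without being tangent to
    it.\<close>
  have "(axis q 1, 0) \<in> skew_complement \<Omega> ({0} \<times> UNIV)"
    unfolding skew_complement_def \<Omega>_def by (auto simp: J_q inner_prod_def)
  moreover have "(axis q 1, 0) \<notin> {0 :: real ^ 'w} \<times> (UNIV :: (real ^ 'n) set)"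
    by (simp add: axis_eq_0_iff)
  ultimately have "\<not> coisotropic (coords \<kappa>) \<Omega> ({\<kappa> w} \<times> torus)"
    unfolding coisotropic_def tangent_space_torus[OF y, symmetric] using y by blast
  then show ?thesis
    using not_isotropic by (simp add: x atropic_def)
qed

end

section \<open>The two kinds of phase space\<close>

lemma (in monotone_system) not_exact_form:
  assumes "snd (J (0, \<phi>)) \<noteq> 0"
  shows "\<not> exact_form (coords \<kappa>) \<Omega>"
proof
  assume exact: "exact_form (coords \<kappa>) \<Omega>"
  have "linear (\<lambda>\<phi>. snd (J (0, \<phi>)))"
    using linear_compose[OF _ linear_compose[OF J_linear linear_snd], of "Pair 0"]
    by (simp add: o_def linear_iff)
  then have "snd (J (0, \<phi>)) = 0"
  proof (rule linear_eq_0_on_span[of _ Basis])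
    fix b :: "real ^ 'n"
    assume b: "b \<in> Basis"
    have "snd (J (0, b)) \<bullet> c = 0" if "c \<in> Basis" for c
    proof -
      \<comment> \<open>Both directions are periodic, so exactness would make all pairings among the
        angular directions vanish.\<close>
      have "\<Omega> (0, b) (0, c) = 0"
      proof (rule exact_form_periodic[OF exact])
        obtain i where "b = axis i 1" using b by (auto simp: Basis_vec_def)
        then show "coords \<kappa> (x + (2 * pi) *\<^sub>R (0, b)) = coords \<kappa> x" for x
          by (intro coords_periodic) auto
        obtain j where "c = axis j 1" using \<open>c \<in> Basis\<close> by (auto simp: Basis_vec_def)
        then show "coords \<kappa> (x + (2 * pi) *\<^sub>R (0, c)) = coords \<kappa> x" for x
          by (intro coords_periodic) auto
      qed
      then show ?thesis by (simp add: \<Omega>_def inner_prod_def)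
    qed
    then show "snd (J (0, b)) = 0"
      by (simp add: euclidean_eq_iff[of _ "0 :: real ^ 'n"])
  qed simp
  with assms show False by simp
qed

text \<open>When \<open>w $ p\<^sub>0\<close> is an angle too, its direction and those of the
  \<open>\<phi>\<close>-space are all periodic. Exactness would then make \<open>e\<close>
  orthogonal to every basis vector, contradicting injectivity of \<open>J\<close>.\<close>

lemma (in monotone_system) not_exact_form_compact:
  assumes "\<And>w. \<kappa> (w + (2 * pi) *\<^sub>R axis p\<^sub>0 1) = \<kappa> w"
  shows "\<not> exact_form (coords \<kappa>) \<Omega>"
proof
  assume exact: "exact_form (coords \<kappa>) \<Omega>"
  have "e \<bullet> c = 0" if "c \<in> Basis" for c
  proof -
    have "\<Omega> (axis p\<^sub>0 1, 0) (0, c) = 0"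
    proof (rule exact_form_periodic[OF exact])
      show "coords \<kappa> (x + (2 * pi) *\<^sub>R (axis p\<^sub>0 1, 0)) = coords \<kappa> x" for x
        using assms by (intro coords_periodic) auto
      obtain j where "c = axis j 1" using \<open>c \<in> Basis\<close> by (auto simp: Basis_vec_def)
      then show "coords \<kappa> (x + (2 * pi) *\<^sub>R (0, c)) = coords \<kappa> x" for x
        by (intro coords_periodic) auto
    qed
    then show ?thesis by (simp add: \<Omega>_def J_p\<^sub>0 inner_prod_def)
  qed
  then have "e = 0"
    by (simp add: euclidean_eq_iff[of e 0])
  then show False
    using J_J[of "(axis p\<^sub>0 1, 0)"] linear_0[OF J_linear] J_p\<^sub>0 by (simp add: zero_prod_def axis_eq_0_iff)
qed

text \<open>The coefficients of a primitive must be periodic in \<open>\<phi>\<close>; those of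
  \<open>\<alpha>\<close> depend on \<open>w\<close> alone. This suffices because the form vanishes
  on pairs of \<open>\<phi>\<close>-directions.\<close>

lemma exact_form_noncompact:
  fixes J :: "(real ^ 'w) \<times> (real ^ 'n) \<Rightarrow> (real ^ 'w) \<times> (real ^ 'n)"
  assumes J: "linear J" and skew: "\<And>x y. J x \<bullet> y = - (x \<bullet> J y)" and iso: "\<And>\<phi>. snd (J (0, \<phi>)) = 0"
  shows "exact_form (coords (id :: real ^ 'w \<Rightarrow> _)) (\<lambda>u v. J u \<bullet> v)"
  unfolding exact_form_def
proof (intro exI conjI allI)
  \<comment> \<open>In the \<open>w\<close>-\<open>w\<close> block both terms of the exterior
    derivative contribute equally, hence the factor 1/2. In the mixed block only one contributes,
    hence the full coefficient.\<close>
  define \<alpha> :: "(real ^ 'w) \<times> (complex ^ 'n) \<Rightarrow> (real ^ 'w) \<times> (real ^ 'n) \<Rightarrow> real"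
    where "\<alpha> x v = J (fst x, 0) \<bullet> ((1 / 2) *\<^sub>R fst v, snd v)" for x v
  have \<alpha>: "\<alpha> (coords id x) v = J (fst x, 0) \<bullet> ((1 / 2) *\<^sub>R fst v, snd v)" for x v
    by (simp add: \<alpha>_def coords_def case_prod_beta)
  have J_add: "J (x + y, 0) = J (x, 0) + J (y, 0)" and J_scale: "J (c *\<^sub>R x, 0) = c *\<^sub>R J (x, 0)" for x y c
    using linear_add[OF J, of "(x, 0)" "(y, 0)"] linear_scale[OF J, of c "(x, 0)"] by simp_all
  show "linear (\<alpha> (coords id x))" for x
    unfolding \<alpha> by (rule linearI) (simp_all add: inner_prod_def inner_add_right algebra_simps)
  have lin: "linear (\<lambda>x. \<alpha> (coords id x) v)" for v
    unfolding \<alpha> by (rule linearI) (simp_all add: J_add J_scale inner_add_left)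
  show "smooth (\<lambda>x. \<alpha> (coords id x) v)" for v
    using smooth_affine[OF lin, of 0] by simp
  have fd: "frechet_derivative (\<lambda>x. \<alpha> (coords id x) v) (at x) = (\<lambda>x. \<alpha> (coords id x) v)" for v x
    using frechet_derivative_at[OF linear_imp_has_derivative[OF lin]] by metis
  show "J u \<bullet> v = frechet_derivative (\<lambda>x. \<alpha> (coords id x) v) (at x) u
      - frechet_derivative (\<lambda>x. \<alpha> (coords id x) u) (at x) v" for x u v
  proof -
    have "J u = J (fst u, 0) + J (0, snd u)"
      using linear_add[OF J, of "(fst u, 0)" "(0, snd u)"] by simp
    then have "J u \<bullet> v = J (fst u, 0) \<bullet> v + J (0, snd u) \<bullet> v"
      by (simp add: inner_add_left)
    moreover have "J (0, snd u) \<bullet> v = - (snd (J (fst v, 0)) \<bullet> snd u)"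
      using skew[of "(0, snd u)" "(fst v, 0)"] iso[of "snd u"] by (simp add: inner_prod_def inner_commute)
    moreover have "fst (J (fst u, 0)) \<bullet> fst v = - (fst (J (fst v, 0)) \<bullet> fst u)"
      using skew[of "(fst u, 0)" "(fst v, 0)"] by (simp add: inner_prod_def inner_commute)
    ultimately show ?thesis
      unfolding fd unfolding \<alpha> by (simp add: inner_prod_def[of "J (fst u, 0)"] inner_prod_def[of "J (fst v, 0)"])
  qed
qed

lemma kronecker_torus_subset_range:
  "kronecker_torus \<pi> X m T \<Longrightarrow> T \<subseteq> range \<pi>"
  unfolding kronecker_torus_def by auto

section \<open>The identity and the angle map as coordinate maps\<close>

lemma coordinate_map_id: "coordinate_map (id :: real ^ 'w \<Rightarrow> _) (\<lambda>x. x) (\<lambda>_. 1)"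
  by unfold_locales (auto simp: vec_eq_iff)

lemma coordinate_map_angles: "coordinate_map (angles :: real ^ 'w \<Rightarrow> _) sin cos"
proof
  show "angles w = angles w' \<longleftrightarrow> (\<forall>i. sin (w $ i) = sin (w' $ i) \<and> cos (w $ i) = cos (w' $ i))"
    for w w' :: "real ^ 'w"
    by (auto simp: angles_def vec_eq_iff complex_eq_iff)
  show "x = y" if sc: "sin x = sin y" "cos x = cos y" "\<bar>x - y\<bar> < 1" for x y :: real
  proof -
    obtain n :: int where n: "x = y + 2 * pi * n"
      using sc(1,2) sin_cos_eq_iff by blast
    \<comment> \<open>The bound 1 on the difference is below one full period
      \<open>2 * pi\<close>.\<close>
    have "n = 0"
    proof (rule ccontr)
      assume "n \<noteq> 0"
      then have "1 \<le> \<bar>real_of_int n\<bar>" by linarith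
      then have "2 * pi * 1 \<le> 2 * pi * \<bar>real_of_int n\<bar>"
        by (intro mult_left_mono) auto
      also have "\<dots> = \<bar>x - y\<bar>"
        by (simp add: n abs_mult)
      finally show False using sc(3) pi_gt3 by linarith
    qed
    then show ?thesis using n by simp
  qed
  show "cos x = 1" if "sin x = 0" "0 < cos x" for x :: real
    using that sin_cos_squared_add[of x] by (simp add: power2_eq_1_iff)
qed (auto intro: derivative_eq_intros)

text \<open>The cosines of the \<open>w\<close>-angles are the real parts of the circle coordinates,
  so the region is the trace of an open set of the ambient space. It serves as the isolating
  neighbourhood in the compact case.\<close>

lemma open_positive_cosines:
  "openin (top_of_set (range (coords angles)))
     (coords angles ` {x :: (real ^ 'w) \<times> (real ^ 'n). \<forall>i. 0 < cos (fst x $ i)})"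
proof -
  let ?P = "{y :: (complex ^ 'w) \<times> (complex ^ 'n). \<forall>i. 0 < Re (fst y $ i)}"
  have "?P = (\<Inter>i. {y. 0 < Re (fst y $ i)})"
    by auto
  also have "open \<dots>"
    by (intro open_INT ballI open_Collect_less continuous_intros) auto
  finally have "open ?P" .
  moreover have "coords angles ` {x :: (real ^ 'w) \<times> (real ^ 'n). \<forall>i. 0 < cos (fst x $ i)}
      = range (coords angles) \<inter> ?P"
    by (auto simp: coords_def angles_def)
  ultimately show ?thesis
    by (simp add: openin_open_Int)
qed

section \<open>Polynomiality of the Hamiltonians\<close>

lemma real_polynomial_function_energy:
  assumes "monotone_system (id :: real ^ 'w \<Rightarrow> _) (\<lambda>x. x) (\<lambda>_. 1) J e p\<^sub>0 p q Z"
  shows "real_polynomial_function (monotone_system.energy (\<lambda>x. x) p\<^sub>0 q Z r :: real ^ 'w \<Rightarrow> real)"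
proof -
  have comp: "real_polynomial_function (\<lambda>w :: real ^ 'w. w $ i)" for i
    by (intro real_polynomial_function.intros(1) bounded_linear_vec_nth)
  show ?thesis
  proof (cases "Z = {}")
    case True
    show ?thesis
      unfolding monotone_system.energy_def[OF assms] if_P[OF True]
      by (intro comp real_polynomial_function.intros(2-)
        real_polynomial_function_power real_polynomial_function_sum real_polynomial_function_divide finite)
  next
    case False
    show ?thesis
      unfolding monotone_system.energy_def[OF assms] if_not_P[OF False]
      by (intro comp real_polynomial_function.intros(2-)
        real_polynomial_function_power real_polynomial_function_sum real_polynomial_function_divide finite)
  qed
qed

lemma trigonometric_polynomial_energy:
  assumes "monotone_system (angles :: real ^ 'w \<Rightarrow> _) sin cos J e p\<^sub>0 p q Z"
  shows "trigonometric_polynomial (monotone_system.energy sin p\<^sub>0 q Z r :: real ^ 'w \<Rightarrow> real)"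
proof -
  have "monotone_system.energy sin p\<^sub>0 q Z r w = r * sin (w $ p\<^sub>0) + (if Z = {} then 0
      else 1 / 3 * (sin (w $ q) * (sin (w $ q) * sin (w $ q)))
        + sin (w $ q) * (\<Sum>i\<in>Z - {q}. sin (w $ i) * sin (w $ i)))" for w :: "real ^ 'w"
    unfolding monotone_system.energy_def[OF assms] by (simp add: power2_eq_square power3_eq_cube)
  then have eq: "monotone_system.energy sin p\<^sub>0 q Z r = (\<lambda>w :: real ^ 'w. r * sin (w $ p\<^sub>0) + (if Z = {} then 0
      else 1 / 3 * (sin (w $ q) * (sin (w $ q) * sin (w $ q)))
        + sin (w $ q) * (\<Sum>i\<in>Z - {q}. sin (w $ i) * sin (w $ i))))"
    by blast
  show ?thesis
  proof (cases "Z = {}")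
    case True
    show ?thesis
      unfolding eq if_P[OF True]
      by (intro trigonometric_polynomial_add trigonometric_polynomial_mult
        trigonometric_polynomial_sum trigonometric_polynomial_sin trigonometric_polynomial_const finite)
  next
    case False
    show ?thesis
      unfolding eq if_not_P[OF False]
      by (intro trigonometric_polynomial_add trigonometric_polynomial_mult
        trigonometric_polynomial_sum trigonometric_polynomial_sin trigonometric_polynomial_const finite)
  qed
qed

section \<open>Choice of the data from the dimensions and the frequency vector\<close>

lemma obtain_monotone_system:
  fixes \<kappa> :: "real ^ 'w \<Rightarrow> 'b::topological_space" and \<omega> :: "real ^ 'n"
  assumes \<kappa>: "coordinate_map \<kappa> s s'" and d: "d \<le> CARD('w)"
    and k: "1 \<le> k" "k \<le> CARD('n)" "k + 1 \<le> CARD('w)"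
    and even: "even (CARD('n) - k)" "even (CARD('w) - k)"
  obtains J e p\<^sub>0 p q Z r where "monotone_system \<kappa> s s' J e p\<^sub>0 p q Z" "\<omega> = r *\<^sub>R e"
    "card Z + d = CARD('w)"
    "k = CARD('n) \<Longrightarrow> (\<And>\<phi>. snd (J (0, \<phi>)) = 0)" "k < CARD('n) \<Longrightarrow> (\<exists>\<phi>. snd (J (0, \<phi>)) \<noteq> 0)"
proof -
  \<comment> \<open>For \<open>\<omega> = 0\<close> any unit vector serves, with speed
    \<open>r = 0\<close>.\<close>
  obtain e :: "real ^ 'n" where e: "norm e = 1" "\<omega> = norm \<omega> *\<^sub>R e"
  proof (cases "\<omega> = 0")
    case True
    then show ?thesis using that[of "axis undefined 1"] by simp
  next
    case False
    then show ?thesis using that[of "sgn \<omega>"] by (simp add: sgn_div_norm)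
  qed
  show thesis
  proof (rule obtain_complex_structure[OF e(1) k even])
    fix J :: "(real ^ 'w) \<times> (real ^ 'n) \<Rightarrow> (real ^ 'w) \<times> (real ^ 'n)" and p\<^sub>0 p q
    assume J: "linear J" "\<And>x. J (J x) = - x" "\<And>x y. J x \<bullet> y = - (x \<bullet> J y)"
        "J (axis p\<^sub>0 1, 0) = (0, e)" "J (axis q 1, 0) = (axis p 1, 0)"
      and fibres: "k = CARD('n) \<Longrightarrow> (\<And>\<phi>. snd (J (0, \<phi>)) = 0)"
        "k < CARD('n) \<Longrightarrow> (\<exists>\<phi>. snd (J (0, \<phi>)) \<noteq> 0)"
    \<comment> \<open>\<open>Z\<close> is empty if the family is to fill the phase space; otherwise
      its prescribed size is at least 1 and leaves room for \<open>q\<close>.\<close>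
    obtain Z where Z: "card Z + d = CARD('w)" "Z = {} \<or> q \<in> Z"
    proof (cases "d = CARD('w)")
      case True
      then show ?thesis using that[of "{}"] by simp
    next
      case False
      then have "1 \<le> CARD('w) - d" using d by simp
      then obtain Z where "q \<in> Z" "card Z = CARD('w) - d"
        using obtain_subset_containing[of UNIV q "CARD('w) - d"] by auto
      then show ?thesis using that[of Z] d by simp
    qed
    have "monotone_system \<kappa> s s' J e p\<^sub>0 p q Z"
      by (intro monotone_system.intro monotone_system_axioms.intro \<kappa> J Z(2))
    then show thesis
      using e(2) Z(1) fibres by (rule that)
  qed
qed

text \<open>\<open>k\<close> will count the \<open>\<phi>\<close>-directions paired with
  \<open>w\<close>-directions in the atropic case. Since \<open>a\<close> and \<open>n\<close> have
  the same parity, 1 or 2 leaves an even remainder on both sides, and both remainders are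
  nonempty.\<close>

lemma obtain_same_parity:
  fixes a n N :: nat
  assumes "a + n = 2 * N" "3 \<le> n" "n \<le> 2 * N - 3"
  obtains k where "1 \<le> k" "k < n" "k + 1 \<le> a" "even (n - k)" "even (a - k)"
proof (cases "even n")
  case True
  moreover from this assms have "even a" "3 \<le> a"
    by presburger+
  ultimately show ?thesis
    using assms that[of 2] by auto
next
  case False
  moreover from this assms have "odd a" "3 \<le> a"
    by presburger+
  ultimately show ?thesis
    using assms that[of 1] by auto
qed

theorem theorem1:
  fixes N n d :: nat and \<omega> :: "real ^ 'n"
  assumes "CARD('n) = n" and "CARD('w::finite) + n = 2 * N"
  shows "
    (2 \<le> N \<and> 1 \<le> n \<and> n \<le> N - 1 \<and> d \<le> 2 * N - n \<longrightarrow>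
      (\<exists>(\<Omega> :: (real ^ 'w) \<times> (real ^ 'n) \<Rightarrow> (real ^ 'w) \<times> (real ^ 'n) \<Rightarrow> real)
         (H :: (real ^ 'w) \<times> (complex ^ 'n) \<Rightarrow> real) X S.
         symplectic_form \<Omega> \<and> exact_form (coords (id :: real ^ 'w \<Rightarrow> _)) \<Omega> \<and>
         (\<exists>h. real_polynomial_function h \<and> (\<forall>w \<phi>. H (coords id (w, \<phi>)) = h w)) \<and>
         hamiltonian_vector_field (coords id) \<Omega> H X \<and>
         kronecker_family id X d S \<and>
         (\<forall>s\<in>S. strictly_isotropic (coords id) \<Omega> ({s} \<times> torus)) \<and>
         (\<forall>m T. kronecker_torus (coords id) X m T \<longrightarrow> T \<subseteq> S \<times> torus) \<and>
         0 \<in> S \<and> has_frequency_vector id X 0 \<omega> \<and>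
         (d = 0 \<longrightarrow> unique_torus (coords id) X ({0} \<times> torus)) \<and>
         (d = 2 * N - n \<longrightarrow> S = UNIV))) \<and>
    (3 \<le> N \<and> 3 \<le> n \<and> n \<le> 2 * N - 3 \<and> d \<le> 2 * N - n \<longrightarrow>
      (\<exists>(\<Omega> :: (real ^ 'w) \<times> (real ^ 'n) \<Rightarrow> (real ^ 'w) \<times> (real ^ 'n) \<Rightarrow> real)
         (H :: (real ^ 'w) \<times> (complex ^ 'n) \<Rightarrow> real) X S.
         symplectic_form \<Omega> \<and> \<not> exact_form (coords (id :: real ^ 'w \<Rightarrow> _)) \<Omega> \<and>
         (\<exists>h. real_polynomial_function h \<and> (\<forall>w \<phi>. H (coords id (w, \<phi>)) = h w)) \<and>
         hamiltonian_vector_field (coords id) \<Omega> H X \<and>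
         kronecker_family id X d S \<and>
         (\<forall>s\<in>S. atropic (coords id) \<Omega> ({s} \<times> torus)) \<and>
         (\<forall>m T. kronecker_torus (coords id) X m T \<longrightarrow> T \<subseteq> S \<times> torus) \<and>
         0 \<in> S \<and> has_frequency_vector id X 0 \<omega> \<and>
         (d = 0 \<longrightarrow> unique_torus (coords id) X ({0} \<times> torus)) \<and>
         (d = 2 * N - n \<longrightarrow> S = UNIV))) \<and>
    (2 \<le> N \<and> 1 \<le> n \<and> n \<le> N - 1 \<and> d \<le> 2 * N - n \<longrightarrow>
      (\<exists>(\<Omega> :: (real ^ 'w) \<times> (real ^ 'n) \<Rightarrow> (real ^ 'w) \<times> (real ^ 'n) \<Rightarrow> real)
         (H :: (complex ^ 'w) \<times> (complex ^ 'n) \<Rightarrow> real) X S.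
         symplectic_form \<Omega> \<and> \<not> exact_form (coords (angles :: real ^ 'w \<Rightarrow> _)) \<Omega> \<and>
         (\<exists>h. trigonometric_polynomial h \<and> (\<forall>w \<phi>. H (coords angles (w, \<phi>)) = h w)) \<and>
         hamiltonian_vector_field (coords angles) \<Omega> H X \<and>
         kronecker_family angles X d S \<and>
         (\<forall>s\<in>S. strictly_isotropic (coords angles) \<Omega> ({s} \<times> torus)) \<and>
         angles 0 \<in> S \<and> has_frequency_vector angles X 0 \<omega> \<and>
         (d = 0 \<longrightarrow> strongly_isolated (coords angles) X ({angles 0} \<times> torus)) \<and>
         (d = 2 * N - n \<longrightarrow> S = torus))) \<and>
    (3 \<le> N \<and> 3 \<le> n \<and> n \<le> 2 * N - 3 \<and> d \<le> 2 * N - n \<longrightarrow>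
      (\<exists>(\<Omega> :: (real ^ 'w) \<times> (real ^ 'n) \<Rightarrow> (real ^ 'w) \<times> (real ^ 'n) \<Rightarrow> real)
         (H :: (complex ^ 'w) \<times> (complex ^ 'n) \<Rightarrow> real) X S.
         symplectic_form \<Omega> \<and> \<not> exact_form (coords (angles :: real ^ 'w \<Rightarrow> _)) \<Omega> \<and>
         (\<exists>h. trigonometric_polynomial h \<and> (\<forall>w \<phi>. H (coords angles (w, \<phi>)) = h w)) \<and>
         hamiltonian_vector_field (coords angles) \<Omega> H X \<and>
         kronecker_family angles X d S \<and>
         (\<forall>s\<in>S. atropic (coords angles) \<Omega> ({s} \<times> torus)) \<and>
         angles 0 \<in> S \<and> has_frequency_vector angles X 0 \<omega> \<and>
         (d = 0 \<longrightarrow> strongly_isolated (coords angles) X ({angles 0} \<times> torus)) \<and>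
         (d = 2 * N - n \<longrightarrow> S = torus)))"
proof (intro conjI impI, goal_cases)
  case 1
  have d: "d \<le> CARD('w)"
    using 1 assms by linarith
  \<comment> \<open>For isotropy every \<open>\<phi>\<close>-direction is paired with a
    \<open>w\<close>-direction; \<open>n \<le> N - 1\<close> leaves at least two further
    \<open>w\<close>-directions for \<open>q\<close> and \<open>p\<close>.\<close>
  have k: "1 \<le> CARD('n)" "CARD('n) \<le> CARD('n)" "CARD('n) + 1 \<le> CARD('w)"
    "even (CARD('n) - CARD('n))" "even (CARD('w) - CARD('n))"
    using 1 assms by presburger+
  obtain J and e :: "real ^ 'n" and p\<^sub>0 p q :: 'w and Z r
    where sys: "monotone_system id (\<lambda>x. x) (\<lambda>_. 1) J e p\<^sub>0 p q Z"
      and \<omega>: "\<omega> = r *\<^sub>R e" and card: "card Z + d = CARD('w)"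
      and iso: "\<And>\<phi>. snd (J (0, \<phi>)) = 0"
    by (rule obtain_monotone_system[OF coordinate_map_id d k, of \<omega>]) (rule that; simp)
  interpret monotone_system id "\<lambda>x. x" "\<lambda>_. 1" J e p\<^sub>0 p q Z r
    by (rule sys)
  have exact: "exact_form (coords id) \<Omega>"
    using exact_form_noncompact[OF J_linear J_skew iso] by (simp only: \<Omega>_def[abs_def])
  have polynomial: "\<exists>h. real_polynomial_function h \<and> (\<forall>w \<phi>. H (coords id (w, \<phi>)) = h w)"
    using real_polynomial_function_energy[OF sys] by (intro exI[of _ energy]) (simp add: H_coords)
  have type: "\<forall>x\<in>S. strictly_isotropic (coords id) \<Omega> ({x} \<times> torus)"
    using strictly_isotropic_on_S k(3) iso by simp
  have zero: "0 \<in> S"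
    using zero_in_S by simp
  have frequency: "has_frequency_vector id X 0 \<omega>"
    unfolding \<omega> by (rule frequency_vector_zero)
  have no_others: "\<forall>m T. kronecker_torus (coords id) X m T \<longrightarrow> T \<subseteq> S \<times> torus"
  proof (intro allI impI)
    fix m T
    assume T: "kronecker_torus (coords id) X m T"
    \<comment> \<open>Here \<open>s'\<close> is constantly 1, so the region of positivity is the
      whole phase space.\<close>
    show "T \<subseteq> S \<times> torus"
      by (rule kronecker_torus_in_S[OF T]) (use kronecker_torus_subset_range[OF T] in simp)
  qed
  have isolated: "d = 0 \<longrightarrow> unique_torus (coords id) X ({0} \<times> torus)"
  proof
    assume "d = 0"
    then have "Z = UNIV"
      using card by (intro card_eq_UNIV_imp_eq_UNIV) simp_all
    then show "unique_torus (coords id) X ({0} \<times> torus)"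
      unfolding unique_torus_def using isolating[of "range (coords id)"] by simp
  qed
  have all: "d = 2 * N - n \<longrightarrow> S = UNIV"
  proof
    assume "d = 2 * N - n"
    then have "card Z = 0"
      using card assms by linarith
    then have "Z = {}" by simp
    then show "S = UNIV"
      using S_eq_range by simp
  qed
  show ?case
    by (intro exI[of _ \<Omega>] exI[of _ H] exI[of _ X] exI[of _ S] conjI
        symplectic exact polynomial hamiltonian kronecker_family[OF card] type no_others zero frequency isolated all)
next
  case 2
  have d: "d \<le> CARD('w)"
    using 2 assms by linarith
  \<comment> \<open>For atropy \<open>k < CARD('n)\<close> leaves \<open>\<phi>\<close>-directions
    that are paired with each other.\<close>
  obtain k where k: "1 \<le> k" "k \<le> CARD('n)" "k + 1 \<le> CARD('w)" "even (CARD('n) - k)" "even (CARD('w) - k)"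
    and less: "k < CARD('n)"
    using obtain_same_parity[of "CARD('w)" "CARD('n)" N] assms 2 by (metis less_imp_le)
  obtain J and e :: "real ^ 'n" and p\<^sub>0 p q :: 'w and Z r
    where sys: "monotone_system id (\<lambda>x. x) (\<lambda>_. 1) J e p\<^sub>0 p q Z"
      and \<omega>: "\<omega> = r *\<^sub>R e" and card: "card Z + d = CARD('w)"
      and "\<exists>\<phi>. snd (J (0, \<phi>)) \<noteq> 0"
    by (rule obtain_monotone_system[OF coordinate_map_id d k, of \<omega>]) (rule that; simp add: less)
  then obtain \<phi>\<^sub>0 where \<phi>\<^sub>0: "snd (J (0, \<phi>\<^sub>0)) \<noteq> 0" by blast
  interpret monotone_system id "\<lambda>x. x" "\<lambda>_. 1" J e p\<^sub>0 p q Z r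
    by (rule sys)
  have exact: "\<not> exact_form (coords id) \<Omega>"
    by (rule not_exact_form[OF \<phi>\<^sub>0])
  have polynomial: "\<exists>h. real_polynomial_function h \<and> (\<forall>w \<phi>. H (coords id (w, \<phi>)) = h w)"
    using real_polynomial_function_energy[OF sys] by (intro exI[of _ energy]) (simp add: H_coords)
  have type: "\<forall>x\<in>S. atropic (coords id) \<Omega> ({x} \<times> torus)"
    using atropic_on_S \<phi>\<^sub>0 by blast
  have zero: "0 \<in> S"
    using zero_in_S by simp
  have frequency: "has_frequency_vector id X 0 \<omega>"
    unfolding \<omega> by (rule frequency_vector_zero)
  have no_others: "\<forall>m T. kronecker_torus (coords id) X m T \<longrightarrow> T \<subseteq> S \<times> torus"
  proof (intro allI impI)
    fix m T
    assume T: "kronecker_torus (coords id) X m T"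
    show "T \<subseteq> S \<times> torus"
      by (rule kronecker_torus_in_S[OF T]) (use kronecker_torus_subset_range[OF T] in simp)
  qed
  have isolated: "d = 0 \<longrightarrow> unique_torus (coords id) X ({0} \<times> torus)"
  proof
    assume "d = 0"
    then have "Z = UNIV"
      using card by (intro card_eq_UNIV_imp_eq_UNIV) simp_all
    then show "unique_torus (coords id) X ({0} \<times> torus)"
      unfolding unique_torus_def using isolating[of "range (coords id)"] by simp
  qed
  have all: "d = 2 * N - n \<longrightarrow> S = UNIV"
  proof
    assume "d = 2 * N - n"
    then have "card Z = 0"
      using card assms by linarith
    then have "Z = {}" by simp
    then show "S = UNIV"
      using S_eq_range by simp
  qed
  show ?case
    by (intro exI[of _ \<Omega>] exI[of _ H] exI[of _ X] exI[of _ S] conjI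
        symplectic exact polynomial hamiltonian kronecker_family[OF card] type no_others zero frequency isolated all)
next
  case 3
  have d: "d \<le> CARD('w)"
    using 3 assms by linarith
  have k: "1 \<le> CARD('n)" "CARD('n) \<le> CARD('n)" "CARD('n) + 1 \<le> CARD('w)"
    "even (CARD('n) - CARD('n))" "even (CARD('w) - CARD('n))"
    using 3 assms by presburger+
  obtain J and e :: "real ^ 'n" and p\<^sub>0 p q :: 'w and Z r
    where sys: "monotone_system angles sin cos J e p\<^sub>0 p q Z"
      and \<omega>: "\<omega> = r *\<^sub>R e" and card: "card Z + d = CARD('w)"
      and iso: "\<And>\<phi>. snd (J (0, \<phi>)) = 0"
    by (rule obtain_monotone_system[OF coordinate_map_angles d k, of \<omega>]) (rule that; simp)
  interpret monotone_system angles sin cos J e p\<^sub>0 p q Z r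
    by (rule sys)
  \<comment> \<open>Although the tori are isotropic, the pairing of the now periodic
    \<open>p\<^sub>0\<close>-direction with \<open>e\<close> obstructs exactness.\<close>
  have exact: "\<not> exact_form (coords angles) \<Omega>"
    by (rule not_exact_form_compact) (simp add: angles_def vec_eq_iff axis_def flip: cis_mult)
  have polynomial: "\<exists>h. trigonometric_polynomial h \<and> (\<forall>w \<phi>. H (coords angles (w, \<phi>)) = h w)"
    using trigonometric_polynomial_energy[OF sys] by (intro exI[of _ energy]) (simp add: H_coords)
  have type: "\<forall>x\<in>S. strictly_isotropic (coords angles) \<Omega> ({x} \<times> torus)"
    using strictly_isotropic_on_S k(3) iso by simp
  have zero: "angles 0 \<in> S"
    using zero_in_S by simp
  have frequency: "has_frequency_vector angles X 0 \<omega>"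
    unfolding \<omega> by (rule frequency_vector_zero)
  have isolated: "d = 0 \<longrightarrow> strongly_isolated (coords angles) X ({angles 0} \<times> torus)"
  proof
    assume "d = 0"
    then have "Z = UNIV"
      using card by (intro card_eq_UNIV_imp_eq_UNIV) simp_all
    \<comment> \<open>The argument controls only the region of positive cosines, whence strong
      isolation instead of uniqueness.\<close>
    then show "strongly_isolated (coords angles) X ({angles 0} \<times> torus)"
      unfolding strongly_isolated_def using isolating[OF _ refl open_positive_cosines] by blast
  qed
  have all: "d = 2 * N - n \<longrightarrow> S = torus"
  proof
    assume "d = 2 * N - n"
    then have "card Z = 0"
      using card assms by linarith
    then have "Z = {}" by simp
    then show "S = torus"
      using S_eq_range by simp
  qed
  show ?case
    by (intro exI[of _ \<Omega>] exI[of _ H] exI[of _ X] exI[of _ S] conjI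
        symplectic exact polynomial hamiltonian kronecker_family[OF card] type zero frequency isolated all)
next
  case 4
  have d: "d \<le> CARD('w)"
    using 4 assms by linarith
  obtain k where k: "1 \<le> k" "k \<le> CARD('n)" "k + 1 \<le> CARD('w)" "even (CARD('n) - k)" "even (CARD('w) - k)"
    and less: "k < CARD('n)"
    using obtain_same_parity[of "CARD('w)" "CARD('n)" N] assms 4 by (metis less_imp_le)
  obtain J and e :: "real ^ 'n" and p\<^sub>0 p q :: 'w and Z r
    where sys: "monotone_system angles sin cos J e p\<^sub>0 p q Z"
      and \<omega>: "\<omega> = r *\<^sub>R e" and card: "card Z + d = CARD('w)"
      and "\<exists>\<phi>. snd (J (0, \<phi>)) \<noteq> 0"
    by (rule obtain_monotone_system[OF coordinate_map_angles d k, of \<omega>]) (rule that; simp add: less)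
  then obtain \<phi>\<^sub>0 where \<phi>\<^sub>0: "snd (J (0, \<phi>\<^sub>0)) \<noteq> 0" by blast
  interpret monotone_system angles sin cos J e p\<^sub>0 p q Z r
    by (rule sys)
  \<comment> \<open>The pairing among the \<open>\<phi>\<close>-directions already obstructs
    exactness, as in the non-compact atropic case.\<close>
  have exact: "\<not> exact_form (coords angles) \<Omega>"
    by (rule not_exact_form[OF \<phi>\<^sub>0])
  have polynomial: "\<exists>h. trigonometric_polynomial h \<and> (\<forall>w \<phi>. H (coords angles (w, \<phi>)) = h w)"
    using trigonometric_polynomial_energy[OF sys] by (intro exI[of _ energy]) (simp add: H_coords)
  have type: "\<forall>x\<in>S. atropic (coords angles) \<Omega> ({x} \<times> torus)"
    using atropic_on_S \<phi>\<^sub>0 by blast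
  have zero: "angles 0 \<in> S"
    using zero_in_S by simp
  have frequency: "has_frequency_vector angles X 0 \<omega>"
    unfolding \<omega> by (rule frequency_vector_zero)
  have isolated: "d = 0 \<longrightarrow> strongly_isolated (coords angles) X ({angles 0} \<times> torus)"
  proof
    assume "d = 0"
    then have "Z = UNIV"
      using card by (intro card_eq_UNIV_imp_eq_UNIV) simp_all
    then show "strongly_isolated (coords angles) X ({angles 0} \<times> torus)"
      unfolding strongly_isolated_def using isolating[OF _ refl open_positive_cosines] by blast
  qed
  have all: "d = 2 * N - n \<longrightarrow> S = torus"
  proof
    assume "d = 2 * N - n"
    then have "card Z = 0"
      using card assms by linarith
    then have "Z = {}" by simp
    then show "S = torus"
      using S_eq_range by simp
  qed
  show ?case
    by (intro exI[of _ \<Omega>] exI[of _ H] exI[of _ X] exI[of _ S] conjI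
        symplectic exact polynomial hamiltonian kronecker_family[OF card] type zero frequency isolated all)
qed

end
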